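(* Let $K$ be a totally imaginary number field, $\overline{K}$ an algebraic closure of $K$, and $E/K$ an elliptic curve with a $K$-rational point $P$ such that $2P\neq O$ and $3P\neq O$. Then for each $\sigma\in Gal(\overline{K}/K)$, $E(\overline{K}^{\sigma})$ has infinite rank.
   Context: $\overline{K}^{\sigma}$ denotes the subfield of $\overline{K}$ fixed by $\sigma$. *)

theory Defs
  imports
    "HOL-Algebra.Algebraic_Closure_Type"
    "HOL-Algebra.Ring"
    "HOL-Library.Extended_Nat"
    Complex_Main
begin

section \<open>Number fields and Galois groups\<close>

text \<open>
  Throughout, an algebraic closure of \<open>K\<close> is a type \<open>'a\<close> whose ring structure
  \<open>ring_of_type_algebra\<close> satisfies the library predicate \<open>algebraic_closure\<close>
  over the subset \<open>K\<close>; \<open>\<rat>\<close> is the prime field of \<open>'a\<close>.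
\<close>

definition number_field :: "'a :: field_char_0 set \<Rightarrow> bool" where
  "number_field K \<longleftrightarrow>
     subfield K (ring_of_type_algebra :: 'a ring) \<and>
     ring.finite_dimension (ring_of_type_algebra :: 'a ring) \<rat> K"

definition complex_embeddings :: "'a :: field_char_0 set \<Rightarrow> ('a \<Rightarrow> complex) set" where
  "complex_embeddings K =
     ring_hom ((ring_of_type_algebra :: 'a ring)\<lparr>carrier := K\<rparr>) ring_of_type_algebra"

definition totally_imaginary :: "'a :: field_char_0 set \<Rightarrow> bool" where
  "totally_imaginary K \<longleftrightarrow> (\<forall>\<tau> \<in> complex_embeddings K. \<not> \<tau> ` K \<subseteq> \<real>)"

definition Gal :: "'a :: field set \<Rightarrow> ('a \<Rightarrow> 'a) set" where
  "Gal K = {\<sigma> \<in> ring_iso ring_of_type_algebra ring_of_type_algebra. \<forall>x\<in>K. \<sigma> x = x}"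

definition fixed_field :: "('a \<Rightarrow> 'a) \<Rightarrow> 'a set" where
  "fixed_field \<sigma> = {x. \<sigma> x = x}"

section \<open>Elliptic curves\<close>

text \<open>
  The record \<open>(a1, a2, a3, a4, a6)\<close> stands for the plane cubic
  \<open>y^2 + a1 x y + a3 y = x^3 + a2 x^2 + a4 x + a6\<close>.
\<close>

record 'a weierstrass =
  a1 :: 'a
  a2 :: 'a
  a3 :: 'a
  a4 :: 'a
  a6 :: 'a

definition discriminant :: "'a :: field weierstrass \<Rightarrow> 'a" where
  "discriminant E =
    (let b2 = (a1 E)^2 + 4 * a2 E;
         b4 = 2 * a4 E + a1 E * a3 E;
         b6 = (a3 E)^2 + 4 * a6 E;
         b8 = (a1 E)^2 * a6 E + 4 * a2 E * a6 E - a1 E * a3 E * a4 E + a2 E * (a3 E)^2 - (a4 E)^2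
     in - (b2^2) * b8 - 8 * b4^3 - 27 * b6^2 + 9 * b2 * b4 * b6)"

definition elliptic_curve_over :: "'a :: field set \<Rightarrow> 'a weierstrass \<Rightarrow> bool" where
  "elliptic_curve_over K E \<longleftrightarrow>
     {a1 E, a2 E, a3 E, a4 E, a6 E} \<subseteq> K \<and> discriminant E \<noteq> 0"

datatype 'a point = Infinity | Affine 'a 'a

definition on_curve :: "'a :: field weierstrass \<Rightarrow> 'a \<Rightarrow> 'a \<Rightarrow> bool" where
  "on_curve E x y \<longleftrightarrow>
     y^2 + a1 E * x * y + a3 E * y = x^3 + a2 E * x^2 + a4 E * x + a6 E"

definition rational_points :: "'a :: field weierstrass \<Rightarrow> 'a set \<Rightarrow> 'a point set" where
  "rational_points E F = insert Infinity {Affine x y | x y. x \<in> F \<and> y \<in> F \<and> on_curve E x y}"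

text \<open>
  Chord-tangent law: \<open>l\<close> is the slope of the line through the two points (of the tangent
  line if they coincide), whose third intersection point with the curve is reflected by
  \<open>(x, y) \<mapsto> (x, - y - a1 x - a3)\<close>.
\<close>

fun point_add :: "'a :: field weierstrass \<Rightarrow> 'a point \<Rightarrow> 'a point \<Rightarrow> 'a point" where
  "point_add E Infinity Q = Q"
| "point_add E P Infinity = P"
| "point_add E (Affine x1 y1) (Affine x2 y2) =
    (if x1 = x2 \<and> y1 + y2 + a1 E * x2 + a3 E = 0 then Infinity
     else
       let l = (if x1 = x2
                then (3 * x1^2 + 2 * a2 E * x1 + a4 E - a1 E * y1) / (2 * y1 + a1 E * x1 + a3 E)
                else (y2 - y1) / (x2 - x1));
           x3 = l^2 + a1 E * l - a2 E - x1 - x2;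
           y3 = y1 + l * (x3 - x1)
       in Affine x3 (- y3 - a1 E * x3 - a3 E))"

text \<open>The group \<open>E(F)\<close>, written multiplicatively as always in HOL-Algebra: \<open>nP\<close> is \<open>P [^] n\<close>.\<close>

definition mordell_weil :: "'a :: field weierstrass \<Rightarrow> 'a set \<Rightarrow> 'a point monoid" where
  "mordell_weil E F =
     \<lparr>carrier = rational_points E F, monoid.mult = point_add E, one = Infinity\<rparr>"

section \<open>Rank of an abelian group\<close>

definition int_independent :: "('a, 'b) monoid_scheme \<Rightarrow> 'a set \<Rightarrow> bool" where
  "int_independent G S \<longleftrightarrow> finite S \<and> S \<subseteq> carrier G \<and>
     (\<forall>c :: 'a \<Rightarrow> int.
        (\<Otimes>\<^bsub>G\<^esub>x\<in>S. x [^]\<^bsub>G\<^esub> c x) = \<one>\<^bsub>G\<^esub> \<longrightarrow> (\<forall>x\<in>S. c x = 0))"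

definition abelian_rank :: "('a, 'b) monoid_scheme \<Rightarrow> enat" where
  "abelian_rank G = (SUP S \<in> {S. int_independent G S}. enat (card S))"

end

theory Submission
  imports Defs
begin

text \<open>
  Let \<open>F\<close> be the fixed field of \<open>\<sigma>\<close>. Since \<open>\<sigma>\<close> sends a square root of an element of \<open>F\<close> to
  plus or minus itself, a product of two nonsquares of \<open>F\<close> is a square. Put the curve in the form
  \<open>y^2 = f x\<close> with \<open>f x = x^3 + a x + b\<close>. If \<open>u + v + z = 0\<close>, \<open>e = u v + v z + z u - a\<close> and
  \<open>t = (u v z + b) / e\<close>, then \<open>f u * f v * f z = e^3 * f t\<close>, so if \<open>e\<close> is a nonsquare of \<open>F\<close>,
  then one of the four values of \<open>f\<close> is a square in \<open>F\<close>.

  Given finitely many independent points of \<open>E(F)\<close>, choose a number field \<open>L\<close> inside \<open>F\<close> over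
  which they are defined, a valuation ring of the algebraic closure lying over a large prime, and an
  element \<open>w\<close> of \<open>L\<close> of large valuation which is not a unit times a square in \<open>L\<close>. Choosing
  \<open>u\<close>, \<open>v\<close>, \<open>z\<close>, \<open>t\<close> in \<open>L\<close> to be units times \<open>1 / w\<close>, one obtains a point \<open>Q = (x, y)\<close> of
  \<open>E(F)\<close> with \<open>x\<close> in \<open>L\<close> and \<open>y\<close> not in \<open>L\<close>. It is so close to infinity that it is not
  torsion, because \<open>x / y\<close> is additive up to higher order there. Conjugation of \<open>L(y)\<close> over \<open>L\<close>
  fixes the given points and negates \<open>Q\<close>, hence \<open>Q\<close> is independent of them.
\<close>

section \<open>Group law on short Weierstrass curves\<close>

text \<open>Why one \<open>w\<close> controls all four values: a nonsquare is taken in the form d =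
  - (x0^2 + x0 y0 + y0^2), and u = x0 g, v = y0 g give e = d g^2 - a. For e to be d times a square
  c^2, the pair (g, c) must lie on the conic g^2 - c^2 = a / d, whose rational parametrization by
  \<open>w\<close> makes g and c behave like 1 / w. Then u, v, z and t all have the same pole, and
  it does not matter at which of them f is a square. If every element of F is a square, x = 1 / w
  serves directly.

  The pole serves two purposes. When x w is a unit, so is y^2 w^3; hence the class of
  \<open>w\<close> modulo units and squares of L keeps y out of L. And p^4 dividing \<open>w\<close>
  makes x / y divisible by p^2, enough for the error terms of multiplication by p to stay small.

  The obstacle is that every element of the algebraic closure is a square there and its value group
  is not discrete. Nonsquare classes therefore have to be found relative to L, from a bound on
  ramification: if p is a unit times an m-th power in L, then m is at most a bound for the degrees
  of the elements of L.\<close>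

definition short_weierstrass :: "'a :: field \<Rightarrow> 'a \<Rightarrow> 'a weierstrass" where
  "short_weierstrass a b = \<lparr>a1 = 0, a2 = 0, a3 = 0, a4 = a, a6 = b\<rparr>"

text \<open>The second equation replaces the first one when the points coincide, so that chords and
  tangents need not be distinguished.\<close>

definition is_slope :: "'a :: field \<Rightarrow> 'a \<Rightarrow> 'a \<Rightarrow> 'a \<Rightarrow> 'a \<Rightarrow> 'a \<Rightarrow> bool" where
  "is_slope a x1 y1 x2 y2 l \<longleftrightarrow>
     y1 - y2 = l * (x1 - x2) \<and> l * (y1 + y2) = x1^2 + x1 * x2 + x2^2 + a"

lemma short_weierstrass_simps [simp]:
  "a1 (short_weierstrass a b) = 0" "a2 (short_weierstrass a b) = 0" "a3 (short_weierstrass a b) = 0"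
  "a4 (short_weierstrass a b) = a" "a6 (short_weierstrass a b) = b"
  by (simp_all add: short_weierstrass_def)

lemma on_curve_short:
  "on_curve (short_weierstrass a b) x y \<longleftrightarrow> y^2 = x^3 + a * x + b"
  by (simp add: on_curve_def)

lemma is_slope_exists:
  fixes a :: "'a :: field_char_0"
  assumes "y1^2 = x1^3 + a * x1 + b" "y2^2 = x2^3 + a * x2 + b"
    and "\<not> (x1 = x2 \<and> y1 + y2 = 0)"
  obtains l where "is_slope a x1 y1 x2 y2 l"
proof (cases "x1 = x2")
  case True
  then have "(y1 - y2) * (y1 + y2) = 0"
    using assms(1,2) by (simp add: algebra_simps power2_eq_square)
  then have "y1 = y2" and "y1 \<noteq> 0"
    using assms(3) True by auto
  then have "is_slope a x1 y1 x2 y2 ((3 * x1^2 + a) / (2 * y1))"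
    using True by (simp add: is_slope_def field_simps power2_eq_square)
  then show thesis by (rule that)
next
  case False
  have "(y1 - y2) * (y1 + y2) = (x1 - x2) * (x1^2 + x1 * x2 + x2^2 + a)"
    using assms(1,2) by Groebner_Basis.algebra
  then have "is_slope a x1 y1 x2 y2 ((y1 - y2) / (x1 - x2))"
    using False by (simp add: is_slope_def field_simps)
  then show thesis by (rule that)
qed

lemma is_slope_unique:
  assumes "is_slope a x1 y1 x2 y2 l" "is_slope a x1 y1 x2 y2 m"
    and "\<not> (x1 = x2 \<and> y1 + y2 = 0)"
  shows "l = m"
proof (cases "x1 = x2")
  case True
  then have "y1 + y2 \<noteq> 0" using assms(3) by simp
  moreover have "l * (y1 + y2) = m * (y1 + y2)"
    using assms(1,2) by (simp add: is_slope_def)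
  ultimately show ?thesis by simp
next
  case False
  then show ?thesis using assms(1,2) by (simp add: is_slope_def)
qed

lemma is_slope_commute: "is_slope a x1 y1 x2 y2 l \<longleftrightarrow> is_slope a x2 y2 x1 y1 l"
  by (auto simp: is_slope_def algebra_simps)

lemma point_add_short:
  fixes a :: "'a :: field_char_0"
  assumes "is_slope a x1 y1 x2 y2 l"
    and "\<not> (x1 = x2 \<and> y1 + y2 = 0)"
  shows "point_add (short_weierstrass a b) (Affine x1 y1) (Affine x2 y2) =
           Affine (l^2 - x1 - x2) (- y1 - l * (l^2 - x1 - x2 - x1))"
proof (cases "x1 = x2")
  case True
  then have "y1 = y2" and "y1 \<noteq> 0"
    using assms by (auto simp: is_slope_def)
  then have "(3 * x1^2 + a) / (2 * y1) = l"
    using assms(1) True by (simp add: is_slope_def field_simps power2_eq_square)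
  then show ?thesis
    using True assms(2) \<open>y1 = y2\<close> \<open>y1 \<noteq> 0\<close>
    by (simp add: Let_def)
next
  case False
  then have "(y2 - y1) / (x2 - x1) = l"
    using assms(1) by (simp add: is_slope_def field_simps)
  then show ?thesis
    using False by (simp add: Let_def)
qed

text \<open>Substituting the line into the cubic gives roots with sum \<open>l^2\<close>, which
  locates the third intersection. It is kept unreflected here, so that each of the two given points
  forms with it a pair of the same slope.\<close>

lemma third_point_on_line:
  fixes a :: "'a :: field_char_0"
  assumes "is_slope a x1 y1 x2 y2 l" and "y1^2 = x1^3 + a * x1 + b"
    and x3: "x3 = l^2 - x1 - x2" and y3: "y3 = y1 + l * (x3 - x1)"
  shows "y3^2 = x3^3 + a * x3 + b" "is_slope a x1 y1 x3 y3 l" "is_slope a x2 y2 x3 y3 l"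
proof -
  have 1: "y1 = y2 + l * (x1 - x2)" and 2: "l * (y1 + y2) = x1^2 + x1 * x2 + x2^2 + a"
    using assms(1) by (auto simp: is_slope_def algebra_simps)
  show s: "is_slope a x1 y1 x3 y3 l"
    unfolding is_slope_def using 1 2 x3 y3 by Groebner_Basis.algebra
  show "is_slope a x2 y2 x3 y3 l"
    unfolding is_slope_def using 1 2 x3 y3 by Groebner_Basis.algebra
  have "(y1 - y3) * (y1 + y3) = (x1 - x3) * (x1^2 + x1 * x3 + x3^2 + a)"
    using s unfolding is_slope_def by Groebner_Basis.algebra
  then show "y3^2 = x3^3 + a * x3 + b"
    using assms(2) by Groebner_Basis.algebra
qed

lemma is_slope_neg: "is_slope a x1 (- y1) x2 (- y2) (- l) \<longleftrightarrow> is_slope a x1 y1 x2 y2 l"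
  by (auto simp: is_slope_def algebra_simps)

fun point_neg :: "'a :: field weierstrass \<Rightarrow> 'a point \<Rightarrow> 'a point" where
  "point_neg E Infinity = Infinity"
| "point_neg E (Affine x y) = Affine x (- y - a1 E * x - a3 E)"

text \<open>If \<open>l \<noteq> m\<close>, the equations for the slopes \<open>l\<close> of \<open>P1, P2\<close> and \<open>m\<close> of \<open>P2, P3\<close> can be solved
  for \<open>y2\<close>, which yields this expression for the slope of \<open>P1 + P2, P3\<close>. The slope of
  \<open>P1, P2 + P3\<close> then differs from it by \<open>l - m\<close>.\<close>

lemma slopes_assoc:
  fixes a :: "'a :: field_char_0"
  assumes "is_slope a x1 y1 x2 y2 l" "is_slope a x2 y2 x3 y3 m" "l \<noteq> m"
    and xA: "xA = l^2 - x1 - x2" and yA: "yA = - y1 - l * (xA - x1)"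
  shows "is_slope a xA yA x3 y3 ((l * m - x2 - xA - x3) / (l - m))"
proof -
  have 1: "y1 = y2 + l * (x1 - x2)" "l * (y1 + y2) = x1^2 + x1 * x2 + x2^2 + a"
    "y3 = y2 - m * (x2 - x3)" "m * (y2 + y3) = x2^2 + x2 * x3 + x3^2 + a"
    using assms(1,2) by (auto simp: is_slope_def algebra_simps)
  have "(l * m - x2 - xA - x3) * (xA - x3) = (yA - y3) * (l - m)"
    using 1 xA yA by Groebner_Basis.algebra
  moreover have "(l * m - x2 - xA - x3) * (yA + y3) = (xA^2 + xA * x3 + x3^2 + a) * (l - m)"
    using 1 xA yA by Groebner_Basis.algebra
  ultimately show ?thesis
    using \<open>l \<noteq> m\<close> by (simp add: is_slope_def field_simps)
qed

section \<open>Group axioms on a nonsingular short curve\<close>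

locale short_curve =
  fixes a b :: "'a :: field_char_0"
  assumes nonsingular: "4 * a^3 + 27 * b^2 \<noteq> 0"
begin

abbreviation "C \<equiv> short_weierstrass a b"

abbreviation pt_add (infixl "\<oplus>\<^sub>C" 65) where "P \<oplus>\<^sub>C Q \<equiv> point_add C P Q"

abbreviation "pts \<equiv> rational_points C UNIV"

lemma Affine_in_pts [simp]: "Affine x y \<in> pts \<longleftrightarrow> y^2 = x^3 + a * x + b"
  by (auto simp: rational_points_def on_curve_short)

lemma Infinity_in_pts [simp]: "Infinity \<in> pts"
  by (simp add: rational_points_def)

lemma add_Infinity_right [simp]: "P \<oplus>\<^sub>C Infinity = P"
  by (cases P) auto

lemma add_neg [simp]: "P \<oplus>\<^sub>C point_neg C P = Infinity" "point_neg C P \<oplus>\<^sub>C P = Infinity"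
  by (cases P; simp)+

lemma neg_neg [simp]: "point_neg C (point_neg C P) = P"
  by (cases P) auto

lemma neg_in_pts [simp]: "point_neg C P \<in> pts \<longleftrightarrow> P \<in> pts"
  by (cases P) auto

lemma Affine_eq_neg_iff: "Affine x2 y2 = point_neg C (Affine x1 y1) \<longleftrightarrow> x1 = x2 \<and> y1 + y2 = 0"
  by (auto simp: add_eq_0_iff)

lemma add_cases:
  assumes "Affine x1 y1 \<in> pts" "Affine x2 y2 \<in> pts"
  obtains (opp) "Affine x2 y2 = point_neg C (Affine x1 y1)"
          "Affine x1 y1 \<oplus>\<^sub>C Affine x2 y2 = Infinity"
  | (slope) l where "\<not> (x1 = x2 \<and> y1 + y2 = 0)" "is_slope a x1 y1 x2 y2 l"
          "Affine x1 y1 \<oplus>\<^sub>C Affine x2 y2 = Affine (l^2 - x1 - x2) (- y1 - l * (l^2 - x1 - x2 - x1))"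
proof (cases "x1 = x2 \<and> y1 + y2 = 0")
  case True
  then have "Affine x2 y2 = point_neg C (Affine x1 y1)"
    by (simp only: Affine_eq_neg_iff)
  then show ?thesis using opp add_neg by metis
next
  case False
  then obtain l where l: "is_slope a x1 y1 x2 y2 l"
    using is_slope_exists assms by (metis Affine_in_pts)
  then show ?thesis
    using slope[OF False l] point_add_short[OF l False] by simp
qed

lemma add_closed: "P \<in> pts \<Longrightarrow> Q \<in> pts \<Longrightarrow> P \<oplus>\<^sub>C Q \<in> pts"
proof (cases P; cases Q)
  fix x1 y1 x2 y2
  assume "P \<in> pts" "Q \<in> pts" and PQ: "P = Affine x1 y1" "Q = Affine x2 y2"
  then have *: "Affine x1 y1 \<in> pts" "Affine x2 y2 \<in> pts" by auto
  from this show "P \<oplus>\<^sub>C Q \<in> pts"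
  proof (cases rule: add_cases)
    case opp
    then show ?thesis by (simp only: PQ Infinity_in_pts)
  next
    case (slope l)
    define x3 where "x3 = l^2 - x1 - x2"
    have "(y1 + l * (x3 - x1))^2 = x3^3 + a * x3 + b"
      using third_point_on_line(1)[OF slope(2) _ x3_def refl] * by simp
    then have "(- y1 - l * (x3 - x1))^2 = x3^3 + a * x3 + b"
      by Groebner_Basis.algebra
    then show ?thesis
      unfolding PQ slope(3) Affine_in_pts x3_def .
  qed
qed auto

lemma add_commute:
  assumes "P \<in> pts" "Q \<in> pts"
  shows "P \<oplus>\<^sub>C Q = Q \<oplus>\<^sub>C P"
proof (cases P; cases Q)
  fix x1 y1 x2 y2
  assume PQ: "P = Affine x1 y1" "Q = Affine x2 y2"
  then have *: "Affine x1 y1 \<in> pts" "Affine x2 y2 \<in> pts" using assms by auto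
  from this show "P \<oplus>\<^sub>C Q = Q \<oplus>\<^sub>C P"
  proof (cases rule: add_cases)
    case opp
    then show ?thesis using PQ add_neg by metis
  next
    case (slope l)
    have "is_slope a x2 y2 x1 y1 l"
      using slope(2) is_slope_commute by blast
    moreover have "\<not> (x2 = x1 \<and> y2 + y1 = 0)"
      using slope(1) by (auto simp: add.commute)
    ultimately have "Q \<oplus>\<^sub>C P = Affine (l^2 - x2 - x1) (- y2 - l * (l^2 - x2 - x1 - x2))"
      using point_add_short PQ by metis
    also have "- y2 - l * (l^2 - x2 - x1 - x2) = - y1 - l * (l^2 - x1 - x2 - x1)"
      using slope(2) unfolding is_slope_def by Groebner_Basis.algebra
    finally show ?thesis using slope(3) PQ by (simp add: algebra_simps)
  qed
qed auto

text \<open>The three equations say that \<open>x\<close> is a double root of the cubic, which the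
  nonvanishing discriminant forbids.\<close>

lemma singular_point:
  assumes "y = 0" "y^2 = x^3 + a * x + b" "3 * x^2 + a = 0"
  shows False
proof -
  have "a = - 3 * x^2" using assms(3) by Groebner_Basis.algebra
  then have "b = 2 * x^3" using assms(1,2) by Groebner_Basis.algebra
  then have "4 * a^3 + 27 * b^2 = 0" using \<open>a = - 3 * x^2\<close> by Groebner_Basis.algebra
  then show False using nonsingular by simp
qed

text \<open>Reflection turns the line through \<open>P\<close> and \<open>Q\<close> into a line
  through \<open>- P\<close>, \<open>- Q\<close> and \<open>P + Q\<close>; hence \<open>- P\<close>
  and \<open>P + Q\<close> add up to \<open>Q\<close>.\<close>

lemma add_neg_cancel:
  assumes "P \<in> pts" "Q \<in> pts"
  shows "point_neg C P \<oplus>\<^sub>C (P \<oplus>\<^sub>C Q) = Q"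
proof (cases P; cases Q)
  fix x1 y1 x2 y2
  assume PQ: "P = Affine x1 y1" "Q = Affine x2 y2"
  then have *: "Affine x1 y1 \<in> pts" "Affine x2 y2 \<in> pts" using assms by auto
  from this show ?thesis
  proof (cases rule: add_cases)
    case opp
    then show ?thesis using PQ by simp
  next
    case (slope l)
    define x3 where "x3 = l^2 - x1 - x2"
    define y3 where "y3 = y1 + l * (x3 - x1)"
    note third = third_point_on_line[OF slope(2) _ x3_def y3_def]
    have s: "is_slope a x1 y1 x3 y3 l" and c3: "y3^2 = x3^3 + a * x3 + b"
      using third * by auto
    \<comment> \<open>If these points were opposite, the line would meet the curve twice at a point
      with \<open>y1 = 0\<close> without being vertical; its slope equation then gives a singular
      point.\<close>
    have "\<not> (x1 = x3 \<and> - y1 + - y3 = 0)"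
    proof
      assume **: "x1 = x3 \<and> - y1 + - y3 = 0"
      then have "x1 = x3" "- y1 + - y3 = 0" by auto
      then have "- y1 + - y1 = 0" using y3_def by simp
      then have "2 * y1 = 0" by Groebner_Basis.algebra
      then have "y1 = 0" by simp
      moreover have "3 * x1^2 + a = 0"
        using s ** unfolding is_slope_def by Groebner_Basis.algebra
      ultimately show False using singular_point * by auto
    qed
    moreover have "is_slope a x1 (- y1) x3 (- y3) (- l)"
      using s by (simp add: is_slope_neg)
    ultimately have "Affine x1 (- y1) \<oplus>\<^sub>C Affine x3 (- y3) =
        Affine ((- l)^2 - x1 - x3) (- (- y1) - (- l) * ((- l)^2 - x1 - x3 - x1))"
      by (rule point_add_short[rotated])
    also have "(- l)^2 - x1 - x3 = x2" by (simp add: x3_def)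
    also have "- (- y1) - (- l) * (x2 - x1) = y2"
      using slope(2) unfolding is_slope_def by Groebner_Basis.algebra
    finally show ?thesis
      using slope(3) PQ by (simp add: x3_def y3_def)
  qed
qed (use assms in auto)

text \<open>In the generic case the slopes \<open>l\<close> of \<open>P1, P2\<close> and
  \<open>m\<close> of \<open>P2, P3\<close> differ. \<open>slopes_assoc\<close>, used once as it
  stands and once with the roles of \<open>P1\<close> and \<open>P3\<close> exchanged, gives the
  slopes \<open>k'\<close> and \<open>n'\<close> of the two outer sums, and
  \<open>n' = k' + l - m\<close> makes the coordinates agree. Opposite neighbours are handled by
  \<open>add_neg_cancel\<close>.\<close>

lemma add_assoc:
  assumes P1: "P1 \<in> pts" and P2: "P2 \<in> pts" and P3: "P3 \<in> pts"
  shows "(P1 \<oplus>\<^sub>C P2) \<oplus>\<^sub>C P3 = P1 \<oplus>\<^sub>C (P2 \<oplus>\<^sub>C P3)"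
proof -
  have opp12: ?thesis if "P2 = point_neg C P1"
    using that add_neg_cancel[of "point_neg C P1" P3] assms by simp
  have opp23: ?thesis if "P3 = point_neg C P2"
    using that add_neg_cancel[of P2 P1] assms add_commute add_closed neg_in_pts
    by (metis add_Infinity_right add_neg(1))
  consider "P1 = Infinity" | "P2 = Infinity" | "P3 = Infinity" | "P2 = point_neg C P1"
    | "P3 = point_neg C P2"
    | x1 y1 x2 y2 x3 y3 where "P1 = Affine x1 y1" "P2 = Affine x2 y2" "P3 = Affine x3 y3"
      "P2 \<noteq> point_neg C P1" "P3 \<noteq> point_neg C P2"
    by (metis point.exhaust)
  then show ?thesis
  proof cases
    case 6
    note PP = 6(1-3)
    have c: "y1^2 = x1^3 + a * x1 + b" "y2^2 = x2^3 + a * x2 + b" "y3^2 = x3^3 + a * x3 + b"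
      using assms PP by auto
    have n12: "\<not> (x1 = x2 \<and> y1 + y2 = 0)" and n23: "\<not> (x2 = x3 \<and> y2 + y3 = 0)"
      using 6 Affine_eq_neg_iff by metis+
    obtain l where l: "is_slope a x1 y1 x2 y2 l" using is_slope_exists[OF c(1,2) n12] .
    obtain m where m: "is_slope a x2 y2 x3 y3 m" using is_slope_exists[OF c(2,3) n23] .
    define xA where "xA = l^2 - x1 - x2"
    define yA where "yA = - y1 - l * (xA - x1)"
    define xB where "xB = m^2 - x2 - x3"
    define yB where "yB = - y2 - m * (xB - x2)"
    have A: "P1 \<oplus>\<^sub>C P2 = Affine xA yA"
      using point_add_short[OF l n12] PP by (simp add: xA_def yA_def)
    have B: "P2 \<oplus>\<^sub>C P3 = Affine xB yB"
      using point_add_short[OF m n23] PP by (simp add: xB_def yB_def)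
    have l': "is_slope a x2 y2 x1 y1 l" and m': "is_slope a x3 y3 x2 y2 m"
      using l m is_slope_commute by blast+
    have i: "y1 = y2 + l * (x1 - x2)" "y3 = y2 - m * (x2 - x3)"
      "l * (y1 + y2) = x1^2 + x1 * x2 + x2^2 + a" "m * (y2 + y3) = x2^2 + x2 * x3 + x3^2 + a"
      using l m by (auto simp: is_slope_def algebra_simps)
    show ?thesis
    proof (cases "l = m")
      \<comment> \<open>A common slope puts all three points on one line, so that either
        \<open>P3 = P1\<close>, where commutativity suffices, or \<open>P3\<close> is the third
        point of the line, namely \<open>- (P1 + P2)\<close>, and both sides are
        \<open>Infinity\<close>.\<close>
      case True
      have "(x1 - x3) * (xA - x3) = 0"
        using i True unfolding xA_def by Groebner_Basis.algebra
      then consider "x3 = x1" | "x3 = xA" by auto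
      then show ?thesis
      proof cases
        case 1
        have "y3 = y1" using i(1,2) True 1 by Groebner_Basis.algebra
        then have "P3 = P1" using 1 PP by simp
        then show ?thesis using assms add_commute add_closed by metis
      next
        case 2
        have "y3 = - yA" using i(1,2) True 2 unfolding yA_def by Groebner_Basis.algebra
        then have "P3 = point_neg C (Affine xA yA)" using 2 PP by simp
        then have L: "(P1 \<oplus>\<^sub>C P2) \<oplus>\<^sub>C P3 = Infinity" using A by simp
        have "xB = x1" using 2 True by (simp add: xA_def xB_def)
        moreover have "yB = - y1"
          using i(1) \<open>xB = x1\<close> True unfolding yB_def by Groebner_Basis.algebra
        ultimately have "Affine xB yB = point_neg C P1" using PP by simp
        then show ?thesis using L B by simp
      qed
    next
      case False
      have k: "is_slope a xA yA x3 y3 ((l * m - x2 - xA - x3) / (l - m))"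
        by (rule slopes_assoc[OF l m False xA_def yA_def])
      have yB': "yB = - y3 - m * (xB - x3)"
        using i(2) unfolding yB_def by Groebner_Basis.algebra
      have xB': "xB = m^2 - x3 - x2" by (simp add: xB_def)
      have "is_slope a xB yB x1 y1 ((m * l - x2 - xB - x1) / (m - l))"
        by (rule slopes_assoc[OF m' l' False[symmetric] xB' yB'])
      then have n: "is_slope a x1 y1 xB yB ((m * l - x2 - xB - x1) / (m - l))"
        using is_slope_commute by blast
      define k' where "k' = (l * m - x2 - xA - x3) / (l - m)"
      define n' where "n' = (m * l - x2 - xB - x1) / (m - l)"
      have kd: "k' * (l - m) = l * m - x2 - xA - x3" and "n' * (m - l) = m * l - x2 - xB - x1"
        using False by (simp_all add: k'_def n'_def)
      then have "(n' - (k' + l - m)) * (l - m) = 0"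
        unfolding xA_def xB_def by Groebner_Basis.algebra
      then have kn: "n' = k' + l - m" using False by simp
      \<comment> \<open>If \<open>P3\<close> were opposite to \<open>P1 + P2\<close>, it would be
        the third point on the line of slope \<open>l\<close>, and uniqueness of the slope of
        \<open>P2, P3\<close> would give \<open>l = m\<close>.\<close>
      have nopp: "\<not> (xA = x3 \<and> yA + y3 = 0)"
      proof
        assume *: "xA = x3 \<and> yA + y3 = 0"
        have "is_slope a x2 y2 xA (y1 + l * (xA - x1)) l"
          using third_point_on_line(3)[OF l c(1) xA_def refl] .
        moreover have "y1 + l * (xA - x1) = y3" using * yA_def
          by (simp add: add_eq_0_iff)
        ultimately have "is_slope a x2 y2 x3 y3 l" using * by simp
        then show False using is_slope_unique[OF _ m n23] False by blast
      qed
      have nopp': "\<not> (x1 = xB \<and> y1 + yB = 0)"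
      proof
        assume *: "x1 = xB \<and> y1 + yB = 0"
        have "is_slope a x2 y2 xB (y2 + m * (xB - x2)) m"
          using third_point_on_line(2)[OF m c(2) xB_def refl] .
        moreover have "y2 + m * (xB - x2) = y1"
          using conjunct2[OF *] yB_def by Groebner_Basis.algebra
        ultimately have "is_slope a x1 y1 x2 y2 m" using * is_slope_commute by metis
        then show False using is_slope_unique[OF l _ n12] False by blast
      qed
      have L: "(P1 \<oplus>\<^sub>C P2) \<oplus>\<^sub>C P3 = Affine (k'^2 - xA - x3) (- yA - k' * (k'^2 - xA - x3 - xA))"
        unfolding A PP(3) k'_def by (rule point_add_short[OF k nopp])
      have R: "P1 \<oplus>\<^sub>C (P2 \<oplus>\<^sub>C P3) = Affine (n'^2 - x1 - xB) (- y1 - n' * (n'^2 - x1 - xB - x1))"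
        unfolding B PP(1) n'_def by (rule point_add_short[OF n nopp'])
      have x: "k'^2 - xA - x3 = n'^2 - x1 - xB"
        using kd unfolding kn xA_def xB_def by Groebner_Basis.algebra
      have "- yA - k' * (k'^2 - xA - x3 - xA) = - y1 - n' * (k'^2 - xA - x3 - x1)"
      proof -
        have "y1 - yB = n' * (x1 - xB)" using n unfolding is_slope_def n'_def by blast
        then have "2 * y1 - l * (x1 - x2) + m * (xB - x2) = (k' + l - m) * (x1 - xB)"
          using i(1) kn unfolding yB_def by Groebner_Basis.algebra
        then have "- 2 * y1 = l * (xA - x1) + k' * (xA - x1) + (l - m) * (k'^2 - xA - x3 - x1)"
          using kd unfolding xA_def xB_def by Groebner_Basis.algebra
        then show ?thesis unfolding yA_def kn by Groebner_Basis.algebra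
      qed
      then show ?thesis unfolding L R x by simp
    qed
  qed (use assms opp12 opp23 in auto)
qed

end

section \<open>Reduction to short Weierstrass form\<close>

text \<open>In terms of the standard invariants, \<open>short_a\<close> is - c4 / 48 and
  \<open>short_b\<close> is - c6 / 864; both come from completing the square in y and then the cube
  in x.\<close>

definition short_a :: "'a :: field_char_0 weierstrass \<Rightarrow> 'a" where
  "short_a E = (2 * a4 E + a1 E * a3 E) / 2 - 3 * (((a1 E)^2 + 4 * a2 E) / 12)^2"

definition short_b :: "'a :: field_char_0 weierstrass \<Rightarrow> 'a" where
  "short_b E = 2 * (((a1 E)^2 + 4 * a2 E) / 12)^3
     - ((a1 E)^2 + 4 * a2 E) / 12 * ((2 * a4 E + a1 E * a3 E) / 2) + ((a3 E)^2 + 4 * a6 E) / 4"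

fun to_short :: "'a :: field_char_0 weierstrass \<Rightarrow> 'a point \<Rightarrow> 'a point" where
  "to_short E Infinity = Infinity"
| "to_short E (Affine x y) = Affine (x + ((a1 E)^2 + 4 * a2 E) / 12) (y + (a1 E * x + a3 E) / 2)"

lemma mult_4_cancel: "4 * x = 4 * y \<Longrightarrow> x = y" for x y :: "'a :: field_char_0"
  by simp

lemma inj_to_short: "inj (to_short E)"
proof
  fix P Q assume "to_short E P = to_short E Q"
  then show "P = Q" by (cases P; cases Q) auto
qed

lemma discriminant_short:
  fixes E :: "'a :: field_char_0 weierstrass"
  shows "discriminant E = - 16 * (4 * short_a E ^ 3 + 27 * short_b E ^ 2)"
proof -
  define h u where "h = ((a1 E)^2 + 4 * a2 E) / 12" and "u = (2 * a4 E + a1 E * a3 E) / 2"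
  define v where "v = ((a3 E)^2 + 4 * a6 E) / 4"
  have *: "(a1 E)^2 + 4 * a2 E = 12 * h" "2 * a4 E + a1 E * a3 E = 2 * u" "(a3 E)^2 + 4 * a6 E = 4 * v"
    by (simp_all add: h_def u_def v_def)
  define b8 where
    "b8 = (a1 E)^2 * a6 E + 4 * a2 E * a6 E - a1 E * a3 E * a4 E + a2 E * (a3 E)^2 - (a4 E)^2"
  have "4 * b8 = (12 * h) * (4 * v) - (2 * u)^2"
    unfolding *[symmetric] b8_def by Groebner_Basis.algebra
  also have "\<dots> = 4 * (12 * h * v - u^2)" by Groebner_Basis.algebra
  finally have b8: "b8 = 12 * h * v - u^2" by (rule mult_4_cancel)
  have "discriminant E = - ((12 * h)^2) * b8 - 8 * (2 * u)^3 - 27 * (4 * v)^2 + 9 * (12 * h) * (2 * u) * (4 * v)"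
    unfolding discriminant_def Let_def * b8_def[symmetric] ..
  also have "\<dots> = - 16 * (4 * (u - 3 * h^2)^3 + 27 * (2 * h^3 - h * u + v)^2)"
    unfolding b8 by Groebner_Basis.algebra
  finally show ?thesis
    by (simp add: short_a_def short_b_def h_def u_def v_def)
qed

lemma on_curve_to_short:
  fixes E :: "'a :: field_char_0 weierstrass"
  shows "on_curve (short_weierstrass (short_a E) (short_b E))
           (x + ((a1 E)^2 + 4 * a2 E) / 12) (y + (a1 E * x + a3 E) / 2) \<longleftrightarrow> on_curve E x y"
proof -
  define h u where "h = ((a1 E)^2 + 4 * a2 E) / 12" and "u = (2 * a4 E + a1 E * a3 E) / 2"
  define v where "v = ((a3 E)^2 + 4 * a6 E) / 4"
  define y' where "y' = y + (a1 E * x + a3 E) / 2"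
  have *: "(a1 E)^2 + 4 * a2 E = 12 * h" "2 * a4 E + a1 E * a3 E = 2 * u" "(a3 E)^2 + 4 * a6 E = 4 * v"
    "2 * y' = 2 * y + a1 E * x + a3 E"
    by (simp_all add: h_def u_def v_def y'_def algebra_simps)
  have "4 * (y'^2 - ((x + h)^3 + (u - 3 * h^2) * (x + h) + (2 * h^3 - h * u + v)))
      = 4 * (y^2 + a1 E * x * y + a3 E * y - (x^3 + a2 E * x^2 + a4 E * x + a6 E))"
    using * by Groebner_Basis.algebra
  then have "y'^2 - ((x + h)^3 + (u - 3 * h^2) * (x + h) + (2 * h^3 - h * u + v))
      = y^2 + a1 E * x * y + a3 E * y - (x^3 + a2 E * x^2 + a4 E * x + a6 E)"
    by (rule mult_4_cancel)
  then have "y'^2 = (x + h)^3 + (u - 3 * h^2) * (x + h) + (2 * h^3 - h * u + v)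
      \<longleftrightarrow> y^2 + a1 E * x * y + a3 E * y = x^3 + a2 E * x^2 + a4 E * x + a6 E"
    by (metis eq_iff_diff_eq_0)
  then show ?thesis
    by (simp add: on_curve_short on_curve_def short_a_def short_b_def h_def u_def v_def y'_def)
qed

lemma to_short_in_points_iff:
  "to_short E P \<in> rational_points (short_weierstrass (short_a E) (short_b E)) UNIV
     \<longleftrightarrow> P \<in> rational_points E UNIV"
  by (cases P) (auto simp: rational_points_def on_curve_to_short)

lemma to_short_neg: "to_short E (point_neg E P) = point_neg (short_weierstrass a b) (to_short E P)"
  by (cases P) (simp_all add: field_simps)

text \<open>The change of variables is affine and maps vertical lines to vertical lines. It sends
  lines of slope \<open>l\<close> to lines of slope \<open>l + a1 E / 2\<close>, for tangents and
  chords alike, so the two addition formulas correspond.\<close>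

lemma to_short_add:
  fixes E :: "'a :: field_char_0 weierstrass"
  assumes "P \<in> rational_points E UNIV" "Q \<in> rational_points E UNIV"
  shows "to_short E (point_add E P Q) =
    point_add (short_weierstrass (short_a E) (short_b E)) (to_short E P) (to_short E Q)"
proof (cases P; cases Q)
  fix x1 y1 x2 y2
  assume PQ: "P = Affine x1 y1" "Q = Affine x2 y2"
  have c: "on_curve E x1 y1" "on_curve E x2 y2"
    using assms PQ by (auto simp: rational_points_def)
  define h where "h = ((a1 E)^2 + 4 * a2 E) / 12"
  define z1 z2 where "z1 = y1 + (a1 E * x1 + a3 E) / 2" and "z2 = y2 + (a1 E * x2 + a3 E) / 2"
  have h: "12 * h = (a1 E)^2 + 4 * a2 E" by (simp add: h_def)
  have z: "2 * z1 = 2 * y1 + a1 E * x1 + a3 E" "2 * z2 = 2 * y2 + a1 E * x2 + a3 E"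
    by (simp_all add: z1_def z2_def algebra_simps)
  have opp: "x1 + h = x2 + h \<and> z1 + z2 = 0 \<longleftrightarrow> x1 = x2 \<and> y1 + y2 + a1 E * x2 + a3 E = 0"
  proof -
    have "z1 + z2 = y1 + y2 + a1 E * x2 + a3 E" if "x1 = x2"
      using that unfolding z1_def z2_def by (simp add: field_simps)
    then show ?thesis by auto
  qed
  show ?thesis
  proof (cases "x1 = x2 \<and> y1 + y2 + a1 E * x2 + a3 E = 0")
    case True
    then show ?thesis using opp PQ by (simp add: h_def z1_def z2_def)
  next
    case False
    define l where "l = (if x1 = x2
                then (3 * x1^2 + 2 * a2 E * x1 + a4 E - a1 E * y1) / (2 * y1 + a1 E * x1 + a3 E)
                else (y2 - y1) / (x2 - x1))"
    define l' where "l' = (if x1 + h = x2 + h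
                then (3 * (x1 + h)^2 + short_a E) / (2 * z1)
                else (z2 - z1) / (x2 + h - (x1 + h)))"
    have l': "l' = l + a1 E / 2"
    proof (cases "x1 = x2")
      case True
      have "(y1 - y2) * (y1 + y2 + a1 E * x2 + a3 E) = 0"
        using c unfolding True on_curve_def by Groebner_Basis.algebra
      then have "y1 = y2" using False True by auto
      then have nz: "2 * z1 \<noteq> 0" "2 * y1 + a1 E * x1 + a3 E \<noteq> 0"
        using False True z by (auto simp: algebra_simps)
      have u: "2 * short_a E = 2 * a4 E + a1 E * a3 E - 6 * h^2"
        by (simp add: short_a_def h_def algebra_simps)
      have "l * (2 * z1) = 3 * x1^2 + 2 * a2 E * x1 + a4 E - a1 E * y1"
        using True nz z by (simp add: l_def)
      moreover have "l' * (2 * z1) = 3 * (x1 + h)^2 + short_a E"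
        using True nz by (simp add: l'_def)
      ultimately have "2 * ((2 * l' - (2 * l + a1 E)) * (2 * z1)) = 0"
        using u h z(1) by Groebner_Basis.algebra
      then have "2 * l' = 2 * l + a1 E" using nz by simp
      then show ?thesis by (simp add: field_simps)
    next
      case False
      then show ?thesis by (simp add: l_def l'_def z1_def z2_def field_simps)
    qed
    define x3 where "x3 = l^2 + a1 E * l - a2 E - x1 - x2"
    define y3 where "y3 = - (y1 + l * (x3 - x1)) - a1 E * x3 - a3 E"
    define x3' where "x3' = l'^2 - (x1 + h) - (x2 + h)"
    have add: "point_add E P Q = Affine x3 y3"
      using False PQ by (simp add: Let_def x3_def y3_def l_def)
    have "point_add (short_weierstrass (short_a E) (short_b E)) (to_short E P) (to_short E Q)
        = Affine x3' (- (z1 + l' * (x3' - (x1 + h))))"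
    proof -
      have "to_short E P = Affine (x1 + h) z1" "to_short E Q = Affine (x2 + h) z2"
        using PQ by (simp_all add: h_def z1_def z2_def)
      moreover have "\<not> (x1 + h = x2 + h \<and> z1 + z2 = 0)" using False opp by blast
      moreover have "point_add (short_weierstrass (short_a E) (short_b E)) (Affine (x1 + h) z1) (Affine (x2 + h) z2)
        = (if x1 + h = x2 + h \<and> z1 + z2 = 0 then Infinity else 
           Affine x3' (- (z1 + l' * (x3' - (x1 + h)))))"
        unfolding x3'_def l'_def point_add.simps Let_def by simp
      ultimately show ?thesis by auto
    qed
    also have "x3' = x3 + h"
    proof -
      have "2 * l' = 2 * l + a1 E" by (simp add: l')
      then have "4 * x3' = 4 * (x3 + h)"
        using h unfolding x3'_def x3_def by Groebner_Basis.algebra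
      then show ?thesis by (rule mult_4_cancel)
    qed
    also have "- (z1 + l' * (x3 + h - (x1 + h))) = y3 + (a1 E * x3 + a3 E) / 2"
      unfolding y3_def l' z1_def by (simp add: field_simps)
    finally show ?thesis unfolding add by (simp add: h_def)
  qed
qed auto

section \<open>Subfields as subsets, and the group of points over a subfield\<close>

locale subring_set =
  fixes R :: "'a :: field_char_0 set"
  assumes one_in [simp, intro]: "1 \<in> R"
    and diff_in [simp, intro]: "x \<in> R \<Longrightarrow> y \<in> R \<Longrightarrow> x - y \<in> R"
    and mult_in [simp, intro]: "x \<in> R \<Longrightarrow> y \<in> R \<Longrightarrow> x * y \<in> R"
begin

lemma zero_in [simp, intro]: "0 \<in> R"
  using diff_in[OF one_in one_in] by simp

lemma uminus_in [simp, intro]: "x \<in> R \<Longrightarrow> - x \<in> R"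
  using diff_in[OF zero_in] by simp

lemma add_in [simp, intro]: "x \<in> R \<Longrightarrow> y \<in> R \<Longrightarrow> x + y \<in> R"
  using diff_in[of x "- y"] by simp

lemma power_in [simp, intro]: "x \<in> R \<Longrightarrow> x ^ n \<in> R"
  by (induction n) auto

lemma of_nat_in [simp, intro]: "of_nat n \<in> R"
  by (induction n) auto

lemma of_int_in [simp, intro]: "of_int n \<in> R"
  by (cases n rule: int_cases2) auto

lemma numeral_in [simp, intro]: "numeral n \<in> R"
  using of_nat_in[of "numeral n"] by simp

lemma sum_in: "(\<And>i. i \<in> I \<Longrightarrow> f i \<in> R) \<Longrightarrow> sum f I \<in> R"
  by (induction I rule: infinite_finite_induct) auto

end

locale subfield_set = subring_set F for F :: "'a :: field_char_0 set" +
  assumes inverse_in [simp, intro]: "x \<in> F \<Longrightarrow> inverse x \<in> F"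
begin

lemma divide_in [simp, intro]: "x \<in> F \<Longrightarrow> y \<in> F \<Longrightarrow> x / y \<in> F"
  by (simp add: divide_inverse)

lemma point_add_in:
  assumes "a1 E \<in> F" "a2 E \<in> F" "a3 E \<in> F" "a4 E \<in> F" "a6 E \<in> F"
    and "P \<in> rational_points E F" "Q \<in> rational_points E F" "point_add E P Q = Affine x y"
  shows "x \<in> F \<and> y \<in> F"
proof (cases P; cases Q)
  fix x1 y1 x2 y2
  assume PQ: "P = Affine x1 y1" "Q = Affine x2 y2"
  then have *: "x1 \<in> F" "y1 \<in> F" "x2 \<in> F" "y2 \<in> F"
    using assms(6,7) by (auto simp: rational_points_def)
  define l where "l = (if x1 = x2
              then (3 * x1^2 + 2 * a2 E * x1 + a4 E - a1 E * y1) / (2 * y1 + a1 E * x1 + a3 E)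
              else (y2 - y1) / (x2 - x1))"
  have l: "l \<in> F" using * assms(1-5) unfolding l_def by auto
  define x3 where "x3 = l^2 + a1 E * l - a2 E - x1 - x2"
  have x3: "x3 \<in> F" using l * assms(1-5) unfolding x3_def by simp
  have "x = x3 \<and> y = - (y1 + l * (x3 - x1)) - a1 E * x3 - a3 E"
    using assms(8)[unfolded PQ point_add.simps, folded l_def, unfolded Let_def, folded x3_def]
    by (auto split: if_splits)
  then show ?thesis using x3 l * assms(1-5) by auto
qed (use assms in \<open>auto simp: rational_points_def\<close>)

text \<open>The laws are pulled back along the injective additive map \<open>to_short\<close> from
  the short curve over the whole field. Restriction to \<open>F\<close> only requires that sums and
  negatives have coordinates in \<open>F\<close>.\<close>

lemma comm_group_mordell_weil:
  assumes "elliptic_curve_over F E"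
  shows "comm_group (mordell_weil E F)"
proof -
  define a b where "a = short_a E" and "b = short_b E"
  define C where "C = short_weierstrass a b"
  interpret short_curve a b
  proof
    show "4 * a^3 + 27 * b^2 \<noteq> 0"
      using assms discriminant_short[of E] unfolding elliptic_curve_over_def a_def b_def
      by (metis mult_zero_right)
  qed
  have coeffs: "a1 E \<in> F" "a2 E \<in> F" "a3 E \<in> F" "a4 E \<in> F" "a6 E \<in> F"
    using assms by (auto simp: elliptic_curve_over_def)
  let ?U = "rational_points E UNIV"
  have sub: "rational_points E F \<subseteq> ?U" by (auto simp: rational_points_def)
  have hom: "to_short E (point_add E P Q) = point_add C (to_short E P) (to_short E Q)"
    if "P \<in> ?U" "Q \<in> ?U" for P Q
    using to_short_add[OF that] by (simp add: C_def a_def b_def)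
  have mem: "to_short E P \<in> rational_points C UNIV \<longleftrightarrow> P \<in> ?U" for P
    using to_short_in_points_iff by (simp add: C_def a_def b_def)
  have cl: "point_add E P Q \<in> ?U" if "P \<in> ?U" "Q \<in> ?U" for P Q
    using that add_closed mem hom by (simp add: C_def flip: mem)
  have clF: "point_add E P Q \<in> rational_points E F"
    if PQ: "P \<in> rational_points E F" "Q \<in> rational_points E F" for P Q
  proof (cases "point_add E P Q")
    case (Affine x y)
    have "on_curve E x y" using cl[of P Q] PQ sub Affine by (auto simp: rational_points_def)
    then show ?thesis using Affine point_add_in[OF coeffs PQ Affine]
      by (simp add: rational_points_def)
  qed (simp add: rational_points_def)
  show ?thesis
  proof (rule comm_groupI, simp_all add: mordell_weil_def clF)
    show "Infinity \<in> rational_points E F" by (simp add: rational_points_def)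
  next
    fix P Q R assume "P \<in> rational_points E F" "Q \<in> rational_points E F" "R \<in> rational_points E F"
    then have *: "P \<in> ?U" "Q \<in> ?U" "R \<in> ?U" using sub by auto
    have "to_short E (point_add E (point_add E P Q) R) = to_short E (point_add E P (point_add E Q R))"
      using add_assoc * by (simp add: hom cl mem C_def[symmetric])
    then show "point_add E (point_add E P Q) R = point_add E P (point_add E Q R)"
      using inj_to_short by (metis injD)
  next
    fix P Q assume "P \<in> rational_points E F" "Q \<in> rational_points E F"
    then have *: "P \<in> ?U" "Q \<in> ?U" using sub by auto
    have "to_short E (point_add E P Q) = to_short E (point_add E Q P)"
      using add_commute * by (simp add: hom mem C_def[symmetric])
    then show "point_add E P Q = point_add E Q P"
      using inj_to_short by (metis injD)
  next
    fix P assume P: "P \<in> rational_points E F"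
    have "point_neg E P \<in> rational_points E F"
    proof (cases P)
      case (Affine x y)
      have "point_neg E P \<in> ?U"
        using to_short_neg[of E P a b] mem neg_in_pts P sub by (metis C_def subsetD)
      then show ?thesis using P Affine coeffs by (auto simp: rational_points_def)
    qed (simp add: rational_points_def)
    moreover have "point_add E (point_neg E P) P = Infinity"
      by (cases P) auto
    ultimately show "\<exists>Q\<in>rational_points E F. point_add E Q P = Infinity" by blast
  qed
qed

end

section \<open>Valuation rings\<close>

text \<open>Only the ring is recorded, not the valuation: \<open>x / y \<in> V\<close> expresses
  that \<open>x\<close> has at least the valuation of a nonzero \<open>y\<close>. The last condition
  says that \<open>p\<close> has positive valuation, so the residue characteristic is
  \<open>p\<close>.\<close>

locale valuation_ring = subring_set V for V :: "'a :: field_char_0 set" +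
  fixes p :: nat
  assumes prime_p: "prime p"
    and in_or_inverse_in: "x \<in> V \<or> inverse x \<in> V"
    and inverse_p_notin: "inverse (of_nat p) \<notin> V"

text \<open>A subring which is maximal among those that do not contain \<open>1 / p\<close> is a valuation ring.\<close>

lemma exists_valuation_ring:
  assumes "prime p"
  shows "\<exists>V :: 'a :: field_char_0 set. valuation_ring V p"
proof -
  let ?q = "inverse (of_nat p) :: 'a"
  have p0: "(of_nat p :: 'a) \<noteq> 0" using assms by (auto simp: prime_gt_0_nat)
  let ?S = "{R :: 'a set. subring_set R \<and> ?q \<notin> R}"
  have Ints: "\<int> \<in> ?S"
  proof -
    have "?q \<notin> \<int>"
    proof
      assume "?q \<in> \<int>"
      then obtain k where "?q = of_int k" by (auto elim: Ints_cases)
      then have "(of_int (k * int p) :: 'a) = of_int 1"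
        using p0 by (simp add: field_simps)
      then have "k * int p = 1" by (simp only: of_int_eq_iff)
      then show False using assms
        by (metis dvd_triv_right int_dvd_int_iff int_ops(2) not_prime_unit)
    qed
    then show ?thesis by (auto intro!: subring_set.intro)
  qed
  have "\<exists>M\<in>?S. \<forall>R\<in>?S. M \<subseteq> R \<longrightarrow> R = M"
  proof (rule subset_Zorn_nonempty)
    show "?S \<noteq> {}" using Ints by blast
  next
    fix \<C> assume C: "\<C> \<noteq> {}" "subset.chain ?S \<C>"
    have sub: "subring_set R" if "R \<in> \<C>" for R
      using C(2) that by (auto simp: subset_chain_def)
    have common: "\<exists>R\<in>\<C>. x \<in> R \<and> y \<in> R" if xy: "x \<in> \<Union>\<C>" "y \<in> \<Union>\<C>" for x y
    proof -
      obtain R R' where "R \<in> \<C>" "x \<in> R" "R' \<in> \<C>" "y \<in> R'" using xy by blast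
      then show ?thesis using C(2) unfolding subset_chain_def by (meson subsetD)
    qed
    have "subring_set (\<Union>\<C>)"
    proof
      show "1 \<in> \<Union>\<C>" using C(1) sub subring_set.one_in by blast
      show "x - y \<in> \<Union>\<C>" if "x \<in> \<Union>\<C>" "y \<in> \<Union>\<C>" for x y
        using common[OF that] sub subring_set.diff_in by blast
      show "x * y \<in> \<Union>\<C>" if "x \<in> \<Union>\<C>" "y \<in> \<Union>\<C>" for x y
        using common[OF that] sub subring_set.mult_in by blast
    qed
    moreover have "?q \<notin> \<Union>\<C>" using C(2) by (auto simp: subset_chain_def)
    ultimately show "\<Union>\<C> \<in> ?S" by blast
  qed
  then obtain V where V: "subring_set V" "?q \<notin> V"
    and max: "\<And>R. subring_set R \<Longrightarrow> ?q \<notin> R \<Longrightarrow> V \<subseteq> R \<Longrightarrow> R = V"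
    by blast
  interpret subring_set V by fact
  \<comment> \<open>\<open>rel x n\<close> expresses 1 / p as a polynomial in \<open>x\<close> of
    degree at most \<open>n\<close> over \<open>V\<close>. By maximality such a relation exists
    whenever \<open>x\<close> lies outside \<open>V\<close>.\<close>
  define rel where "rel x n \<longleftrightarrow> (\<exists>c. (\<forall>i. c i \<in> V) \<and> of_nat p * (\<Sum>i\<le>n. c i * x ^ i) = 1)" for x n
  have adjoin: "\<exists>n. rel x n" if "x \<notin> V" for x
  proof -
    define R where "R = {poly f x | f. \<forall>i. coeff f i \<in> V}"
    have sR: "subring_set R"
    proof
      show "1 \<in> R" unfolding R_def by (auto intro!: exI[of _ 1] simp: coeff_1)
      show "u - v \<in> R" if uv: "u \<in> R" "v \<in> R" for u v
      proof -
        obtain f g where "u = poly f x" "v = poly g x" "\<forall>i. coeff f i \<in> V" "\<forall>i. coeff g i \<in> V"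
          using uv unfolding R_def by blast
        then show ?thesis unfolding R_def by (auto intro!: exI[of _ "f - g"])
      qed
      show "u * v \<in> R" if uv: "u \<in> R" "v \<in> R" for u v
      proof -
        obtain f g where "u = poly f x" "v = poly g x" "\<forall>i. coeff f i \<in> V" "\<forall>i. coeff g i \<in> V"
          using uv unfolding R_def by blast
        then show ?thesis unfolding R_def by (auto intro!: exI[of _ "f * g"] sum_in simp: coeff_mult)
      qed
    qed
    have "V \<subseteq> R"
    proof
      fix v assume "v \<in> V"
      then show "v \<in> R" unfolding R_def
        by (auto intro!: exI[of _ "[:v:]"] simp: coeff_pCons split: nat.split)
    qed
    moreover have "x \<in> R" unfolding R_def
      by (auto intro!: exI[of _ "[:0, 1:]"] simp: coeff_pCons split: nat.split)
    ultimately have "?q \<in> R" using max[OF sR] that by blast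
    then obtain f where "?q = poly f x" and f: "\<forall>i. coeff f i \<in> V" unfolding R_def by blast
    then have "?q = (\<Sum>i\<le>degree f. coeff f i * x ^ i)" by (simp add: poly_altdef)
    then have "of_nat p * (\<Sum>i\<le>degree f. coeff f i * x ^ i) = 1"
      using p0 by (metis right_inverse)
    then show ?thesis unfolding rel_def using f by blast
  qed
  have not_pV: "of_nat p * v \<noteq> 1" if "v \<in> V" for v
    using V(2) that by (metis inverse_unique)
  have one_plus: "\<exists>v'\<in>V. (1 + of_nat p * v) ^ n = 1 + of_nat p * v'" if "v \<in> V" for v n
  proof (induction n)
    case 0
    show ?case by (auto intro!: bexI[of _ 0])
  next
    case (Suc n)
    then obtain v' where "v' \<in> V" "(1 + of_nat p * v) ^ n = 1 + of_nat p * v'" by blast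
    then show ?case using that
      by (auto intro!: bexI[of _ "v + v' + of_nat p * v * v'"] simp: algebra_simps)
  qed
  \<comment> \<open>A relation for the inverse, multiplied by a power of \<open>1 + p v\<close>,
    would put that power into p V, whereas all powers of \<open>1 + p v\<close> are 1 modulo p
    V.\<close>
  have unit: "inverse (1 + of_nat p * v) \<in> V" if v: "v \<in> V" for v
  proof (rule ccontr)
    let ?u = "1 + of_nat p * v"
    assume "inverse ?u \<notin> V"
    then obtain n c where c: "\<And>i. c i \<in> V" "of_nat p * (\<Sum>i\<le>n. c i * inverse ?u ^ i) = 1"
      using adjoin unfolding rel_def by blast
    have u0: "?u \<noteq> 0"
    proof
      assume "?u = 0"
      then have "of_nat p * (- v) = 1" by (simp add: add_eq_0_iff)
      then show False using not_pV v by blast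
    qed
    have "?u ^ n = ?u ^ n * (of_nat p * (\<Sum>i\<le>n. c i * inverse ?u ^ i))" using c(2) by simp
    also have "\<dots> = of_nat p * (\<Sum>i\<le>n. c i * (?u ^ n * inverse ?u ^ i))"
      by (simp add: sum_distrib_left mult_ac)
    also have "(\<Sum>i\<le>n. c i * (?u ^ n * inverse ?u ^ i)) = (\<Sum>i\<le>n. c i * ?u ^ (n - i))"
      using u0 by (intro sum.cong refl) (simp add: power_diff field_simps)
    finally have "?u ^ n = of_nat p * (\<Sum>i\<le>n. c i * ?u ^ (n - i))" .
    moreover have "(\<Sum>i\<le>n. c i * ?u ^ (n - i)) \<in> V" using c(1) v by (intro sum_in) auto
    ultimately obtain w where "w \<in> V" "?u ^ n = of_nat p * w" by blast
    moreover obtain v' where "v' \<in> V" "?u ^ n = 1 + of_nat p * v'" using one_plus[OF v] by blast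
    ultimately have "of_nat p * (w - v') = 1" "w - v' \<in> V" by (auto simp: algebra_simps)
    then show False using not_pV by blast
  qed
  \<comment> \<open>The relation for \<open>inverse x\<close>, multiplied by \<open>x ^ n\<close>,
    expresses \<open>x ^ n\<close> through lower powers, because \<open>1 - p d 0\<close> is a unit;
    substitution shortens the relation for \<open>x\<close>. Two relations of least length, for
    \<open>x\<close> and for \<open>inverse x\<close>, are thus contradictory.\<close>
  have reduce: "\<exists>k<n. rel x k"
    if x0: "x \<noteq> 0" and nm: "m \<le> n" and n: "rel x n" and m: "rel (inverse x) m" for x n m
  proof -
    obtain c where c: "\<And>i. c i \<in> V" "of_nat p * (\<Sum>i\<le>n. c i * x ^ i) = 1"
      using n unfolding rel_def by blast
    obtain d' where d': "\<And>i. d' i \<in> V" "of_nat p * (\<Sum>i\<le>m. d' i * inverse x ^ i) = 1"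
      using m unfolding rel_def by blast
    define d where "d i = (if i \<le> m then d' i else 0)" for i
    have d: "\<And>i. d i \<in> V" using d'(1) by (simp add: d_def)
    have "(\<Sum>i\<le>n. d i * inverse x ^ i) = (\<Sum>i\<le>m. d' i * inverse x ^ i)"
      using nm by (intro sum.mono_neutral_cong_right) (auto simp: d_def)
    then have "x ^ n = x ^ n * (of_nat p * (\<Sum>i\<le>n. d i * inverse x ^ i))" using d'(2) by simp
    also have "\<dots> = of_nat p * (\<Sum>i\<le>n. d i * (x ^ n * inverse x ^ i))"
      by (simp add: sum_distrib_left mult_ac)
    also have "(\<Sum>i\<le>n. d i * (x ^ n * inverse x ^ i)) = (\<Sum>i\<le>n. d i * x ^ (n - i))"
      using x0 by (intro sum.cong refl) (simp add: power_diff field_simps)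
    also have "\<dots> = d 0 * x ^ n + (\<Sum>i<n. d (Suc i) * x ^ (n - Suc i))"
      by (subst sum.atMost_shift) simp
    also have "(\<Sum>i<n. d (Suc i) * x ^ (n - Suc i)) = (\<Sum>i<n. d (n - i) * x ^ i)"
      by (subst sum.nat_diff_reindex[symmetric]) (auto intro!: sum.cong simp: Suc_diff_Suc)
    finally have *: "(1 + of_nat p * - d 0) * x ^ n = of_nat p * (\<Sum>i<n. d (n - i) * x ^ i)"
      by (simp add: algebra_simps)
    define u where "u = inverse (1 + of_nat p * - d 0)"
    have u: "u \<in> V" unfolding u_def using d by (intro unit) auto
    have "1 + of_nat p * - d 0 \<noteq> 0"
      using not_pV[of "d 0"] d by (auto simp: algebra_simps)
    then have xn: "x ^ n = of_nat p * u * (\<Sum>i<n. d (n - i) * x ^ i)"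
      using * unfolding u_def by (simp add: field_simps)
    have n0: "n \<noteq> 0"
    proof
      assume "n = 0"
      then show False using c not_pV[of "c 0"] by simp
    qed
    have "1 = of_nat p * ((\<Sum>i<n. c i * x ^ i) + c n * x ^ n)"
      using c(2) by (simp add: lessThan_Suc_atMost[symmetric])
    also have "\<dots> = of_nat p * (\<Sum>i<n. (c i + c n * of_nat p * u * d (n - i)) * x ^ i)"
      unfolding xn by (simp add: sum.distrib sum_distrib_left algebra_simps)
    also have "{..<n} = {..n - 1}" using n0 by auto
    finally have "rel x (n - 1)"
      unfolding rel_def using c(1) d u
      by (auto intro!: exI[of _ "\<lambda>i. c i + c n * of_nat p * u * d (n - i)"])
    then show ?thesis using n0 by (auto intro!: exI[of _ "n - 1"])
  qed
  have "x \<in> V \<or> inverse x \<in> V" for x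
  proof (rule ccontr)
    assume "\<not> (x \<in> V \<or> inverse x \<in> V)"
    then have ex: "\<exists>n. rel x n" "\<exists>n. rel (inverse x) n" and x0: "x \<noteq> 0"
      using adjoin by auto
    define n m where "n = (LEAST n. rel x n)" and "m = (LEAST n. rel (inverse x) n)"
    have nm: "rel x n" "rel (inverse x) m" using ex unfolding n_def m_def by (meson LeastI)+
    have least: "\<not> rel x k" if "k < n" for k using that not_less_Least unfolding n_def by blast
    have least': "\<not> rel (inverse x) k" if "k < m" for k using that not_less_Least unfolding m_def by blast
    show False
    proof (cases "m \<le> n")
      case True
      then show False using reduce[OF x0 True nm] least by blast
    next
      case False
      then show False using reduce[of "inverse x" n m] nm x0 least' by auto
    qed
  qed
  then show ?thesis using V assms
    by (intro exI[of _ V]) (unfold_locales, auto)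
qed

section \<open>Points near infinity\<close>

context valuation_ring begin

definition val_unit :: "'a \<Rightarrow> bool" where
  "val_unit x \<longleftrightarrow> x \<noteq> 0 \<and> x \<in> V \<and> inverse x \<in> V"

definition val_ideal :: "'a set" where
  "val_ideal = {x \<in> V. \<not> val_unit x}"

lemma val_unitD [dest]: "val_unit x \<Longrightarrow> x \<noteq> 0" "val_unit x \<Longrightarrow> x \<in> V" "val_unit x \<Longrightarrow> inverse x \<in> V"
  by (auto simp: val_unit_def)

lemma val_unit_1 [simp]: "val_unit 1"
  by (simp add: val_unit_def)

lemma val_unit_mult: "val_unit x \<Longrightarrow> val_unit y \<Longrightarrow> val_unit (x * y)"
  by (auto simp: val_unit_def)

lemma val_unit_inverse: "val_unit x \<Longrightarrow> val_unit (inverse x)"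
  by (auto simp: val_unit_def)

lemma val_unit_divide: "val_unit x \<Longrightarrow> val_unit y \<Longrightarrow> val_unit (x / y)"
  by (simp add: divide_inverse val_unit_mult val_unit_inverse)

lemma val_unit_power: "val_unit x \<Longrightarrow> val_unit (x ^ n)"
  by (induction n) (auto intro: val_unit_mult)

lemma val_unit_uminus: "val_unit x \<Longrightarrow> val_unit (- x)"
  by (auto simp: val_unit_def)

lemma divide_unit_in: "x \<in> V \<Longrightarrow> val_unit u \<Longrightarrow> x / u \<in> V"
  by (auto simp: divide_inverse)

lemma val_unit_factor: "val_unit (x * y) \<Longrightarrow> x \<in> V \<Longrightarrow> y \<in> V \<Longrightarrow> val_unit x"
proof -
  assume *: "val_unit (x * y)" "x \<in> V" "y \<in> V"
  have "inverse x = y * inverse (x * y)" using *(1) by (auto simp: val_unit_def)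
  then show "val_unit x" using * unfolding val_unit_def
    by (metis mult_eq_0_iff mult_in)
qed

lemma val_ideal_in [dest]: "x \<in> val_ideal \<Longrightarrow> x \<in> V"
  by (simp add: val_ideal_def)

lemma val_ideal_mult: "x \<in> val_ideal \<Longrightarrow> y \<in> V \<Longrightarrow> x * y \<in> val_ideal"
  unfolding val_ideal_def using val_unit_factor by blast

text \<open>Of two nonzero elements one divides the other in \<open>V\<close>, so the sum is a
  multiple of that one.\<close>

lemma val_ideal_add: 
  assumes "x \<in> val_ideal" "y \<in> val_ideal"
  shows "x + y \<in> val_ideal"
proof -
  have *: "x + y \<in> val_ideal" if "x \<in> val_ideal" "y \<in> val_ideal" "y \<noteq> 0" "x / y \<in> V" for x y
  proof -
    have "x + y = y * (1 + x / y)" using that by (simp add: field_simps)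
    then show ?thesis using val_ideal_mult that by simp
  qed
  have "y / x \<in> V \<or> x / y \<in> V" using in_or_inverse_in[of "x / y"] by auto
  then show ?thesis using *[of x y] *[of y x] assms by (cases "x = 0 \<or> y = 0") (auto simp: add.commute)
qed

lemma val_ideal_uminus: "x \<in> val_ideal \<Longrightarrow> - x \<in> val_ideal"
  using val_ideal_mult[of x "- 1"] by simp

lemma val_unit_add_ideal:
  assumes "val_unit u" "m \<in> val_ideal"
  shows "val_unit (u + m)"
proof (rule ccontr)
  assume "\<not> val_unit (u + m)"
  then have "u + m \<in> val_ideal" using assms by (auto simp: val_ideal_def)
  then have "u + m + - m \<in> val_ideal" using assms val_ideal_add val_ideal_uminus by blast
  then show False using assms(1) by (simp add: val_ideal_def)
qed

lemma p_nonzero [simp]: "p \<noteq> 0"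
  using prime_p by auto

lemma p_in_val_ideal: "of_nat p \<in> val_ideal"
  using inverse_p_notin by (simp add: val_ideal_def val_unit_def)

lemma val_unit_of_int:
  assumes "\<not> int p dvd n"
  shows "val_unit (of_int n)"
proof -
  have "coprime (int p) n" using assms prime_p by (simp add: prime_imp_coprime)
  then obtain u v where "u * int p + v * n = 1" using coprime_iff_gcd_eq_1 bezout_int by metis
  then have "of_int n * of_int v = (1 :: 'a) + of_nat p * of_int (- u)"
    by (metis (no_types, lifting) add.commute add_diff_cancel_left' minus_mult_right mult.commute of_int_1 of_int_add
        of_int_minus of_int_mult of_int_of_nat_eq uminus_add_conv_diff diff_add_cancel)
  moreover have "val_unit ((1 :: 'a) + of_nat p * of_int (- u))"
    by (intro val_unit_add_ideal val_ideal_mult[OF p_in_val_ideal] val_unit_1 of_int_in)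
  ultimately have "val_unit (of_int n * of_int v)" by simp
  then show ?thesis by (rule val_unit_factor) auto
qed

lemma square_in_imp_in: "x^2 \<in> V \<Longrightarrow> x \<in> V"
proof (cases "x = 0")
  case False
  assume "x^2 \<in> V"
  moreover have "x = x^2 * inverse x" using False by (simp add: power2_eq_square)
  ultimately show ?thesis using in_or_inverse_in[of x] by (metis mult_in)
qed auto

end

locale integral_short_curve = short_curve a b + valuation_ring V p
  for a b :: "'a :: field_char_0" and V :: "'a set" and p :: nat +
  assumes a_in: "a \<in> V" and b_in: "b \<in> V"
begin

text \<open>Up to sign, the usual parameter - x / y of the formal group. Points with
  \<open>y = 0\<close> get the value 0 of a division by zero, but they never occur in
  \<open>near_Infinity\<close>.\<close>

fun parameter :: "'a point \<Rightarrow> 'a" where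
  "parameter Infinity = 0"
| "parameter (Affine x y) = x / y"

text \<open>In the coordinates \<open>t = x / y\<close> and \<open>s = 1 / y\<close> the point at infinity is the origin.\<close>

definition near_Infinity :: "'a \<Rightarrow> 'a point set" where
  "near_Infinity c = insert Infinity
     {Affine (t / s) (1 / s) | t s. s \<noteq> 0 \<and> s = t^3 + a * t * s^2 + b * s^3 \<and> t / c \<in> V \<and> s / c^3 \<in> V}"

lemma near_Infinity_in_pts: "P \<in> near_Infinity c \<Longrightarrow> P \<in> pts"
proof (cases P)
  case (Affine x y)
  assume "P \<in> near_Infinity c"
  then obtain t s where "x = t / s" "y = 1 / s" "s \<noteq> 0" and s: "s = t^3 + a * t * s^2 + b * s^3"
    using Affine by (auto simp: near_Infinity_def)
  have "(1 / s)^2 = s / s^3" using \<open>s \<noteq> 0\<close> by (simp add: power_numeral_reduce field_simps)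
  also have "\<dots> = (t^3 + a * t * s^2 + b * s^3) / s^3" using s by simp
  also have "\<dots> = (t / s)^3 + a * (t / s) + b" using \<open>s \<noteq> 0\<close> by (simp add: power_numeral_reduce field_simps)
  finally show ?thesis using Affine \<open>x = t / s\<close> \<open>y = 1 / s\<close> by simp
qed auto

text \<open>Addition is given by lines in the (t, s) plane as well. Since t has order c and s has
  order c^3, the line s = \<alpha> t + \<beta> has \<alpha> of order c^2 and \<beta> of order c^3.
  The sum of the three parameters on it is the error term; it even has order c^5, but c^2 suffices
  later.\<close>

lemma add_near_Infinity:
  assumes c: "c \<in> val_ideal" "c \<noteq> 0" and P: "P \<in> near_Infinity c" and Q: "Q \<in> near_Infinity c"
  shows "P \<oplus>\<^sub>C Q \<in> near_Infinity c \<and>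
    (\<exists>v\<in>V. parameter (P \<oplus>\<^sub>C Q) = parameter P + parameter Q + c^2 * v)"
proof -
  consider "P = Infinity" | "Q = Infinity" | "Q = point_neg C P"
    | x1 y1 x2 y2 where "P = Affine x1 y1" "Q = Affine x2 y2" "Q \<noteq> point_neg C P"
    by (metis point.exhaust)
  then show ?thesis
  proof cases
    case 3
    then have "parameter P + parameter Q = 0" by (cases P) auto
    then show ?thesis using 3 by (auto simp: near_Infinity_def intro!: bexI[of _ 0])
  next
    case 4
    obtain t1 s1 where 1: "x1 = t1 / s1" "y1 = 1 / s1" "s1 \<noteq> 0" "s1 = t1^3 + a * t1 * s1^2 + b * s1^3"
        "t1 / c \<in> V" "s1 / c^3 \<in> V"
      using P 4 by (auto simp: near_Infinity_def)
    obtain t2 s2 where 2: "x2 = t2 / s2" "y2 = 1 / s2" "s2 \<noteq> 0" "s2 = t2^3 + a * t2 * s2^2 + b * s2^3"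
        "t2 / c \<in> V" "s2 / c^3 \<in> V"
      using Q 4 by (auto simp: near_Infinity_def)
    define T1 T2 S1 S2 where "T1 = t1 / c" and "T2 = t2 / c" and "S1 = s1 / c^3" and "S2 = s2 / c^3"
    have TS: "T1 \<in> V" "T2 \<in> V" "S1 \<in> V" "S2 \<in> V" "t1 = c * T1" "t2 = c * T2" "s1 = c^3 * S1" "s2 = c^3 * S2"
      using 1 2 c(2) by (simp_all add: T1_def T2_def S1_def S2_def)
    have cV: "c \<in> V" using c by auto
    have curve: "y1^2 = x1^3 + a * x1 + b" "y2^2 = x2^3 + a * x2 + b"
      using near_Infinity_in_pts[OF P] near_Infinity_in_pts[OF Q] 4(1,2) by simp_all
    have nopp: "\<not> (x1 = x2 \<and> y1 + y2 = 0)" using 4 Affine_eq_neg_iff by metis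
    \<comment> \<open>Subtracting the two curve equations gives
      \<open>(s1 - s2) * N = (t1 - t2) * (...)\<close>. As \<open>N\<close> is a unit, the quotient
      is a slope that makes sense also for \<open>t1 = t2\<close>.\<close>
    define N where "N = 1 - a * t1 * (s1 + s2) - b * (s1^2 + s1 * s2 + s2^2)"
    have N: "val_unit N"
    proof -
      have "N = 1 + c * - (a * T1 * (s1 + s2) + b * c^2 * (S1 * s1 + S1 * s2 + S2 * s2))"
        unfolding N_def TS(5-8) by Groebner_Basis.algebra
      also have "val_unit \<dots>"
        using TS cV a_in b_in by (intro val_unit_add_ideal val_ideal_mult c) auto
      finally show ?thesis .
    qed
    then have N0: "N \<noteq> 0" by auto
    \<comment> \<open>\<open>s = \<alpha> t + \<beta>\<close> is the line through the two points, or the tangent line if they coincide\<close>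
    define \<alpha> where "\<alpha> = (t1^2 + t1 * t2 + t2^2 + a * s2^2) / N"
    define \<beta> where "\<beta> = s1 - \<alpha> * t1"
    define A where "A = (T1^2 + T1 * T2 + T2^2 + a * c^4 * S2^2) / N"
    have A: "A \<in> V" "\<alpha> = c^2 * A"
      unfolding A_def \<alpha>_def TS using TS cV a_in
      by (auto intro!: divide_unit_in N simp: algebra_simps power2_eq_square power_numeral_reduce)
    define B where "B = S1 - A * T1"
    have B: "B \<in> V" "\<beta> = c^3 * B"
      unfolding B_def \<beta>_def A(2) TS using TS A
      by (auto simp: algebra_simps power2_eq_square power_numeral_reduce)
    have \<alpha>N: "\<alpha> * N = t1^2 + t1 * t2 + t2^2 + a * s2^2" using N0 by (simp add: \<alpha>_def)
    have "(s1 - s2) * N = (t1 - t2) * (t1^2 + t1 * t2 + t2^2 + a * s2^2)"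
      using 1(4) 2(4) unfolding N_def by Groebner_Basis.algebra
    then have "(s1 - s2) * N = \<alpha> * (t1 - t2) * N" using \<alpha>N by Groebner_Basis.algebra
    then have line: "s1 - s2 = \<alpha> * (t1 - t2)" using N0 by simp
    have \<beta>2: "\<beta> = s2 - \<alpha> * t2" using line by (simp add: \<beta>_def algebra_simps)
    have same: "t1 = t2 \<and> s1 = s2" if "x1 = x2"
    proof -
      have "(y1 - y2) * (y1 + y2) = 0" using curve that by (simp add: algebra_simps power2_eq_square)
      then have "y1 = y2" using nopp that by auto
      then show ?thesis using that 1(1-3) 2(1-3) by simp
    qed
    \<comment> \<open>The slope equation for a doubled point, with \<open>N\<close> eliminated by
      the curve equation. It serves to exclude \<open>\<beta> = 0\<close> and to recognize the
      tangent slope in the (x, y) plane.\<close>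
    have tangent: "(s1 - \<alpha> * t1) * (3 * t1^2 + a * s1^2) = - 2 * \<alpha> * s1" if "x1 = x2"
    proof -
      have "t2 = t1" "s2 = s1" using same that by auto
      then have "\<alpha> * (1 - 2 * a * t1 * s1 - 3 * b * s1^2) = 3 * t1^2 + a * s1^2"
        using \<alpha>N unfolding N_def by (simp add: algebra_simps power2_eq_square)
      then show ?thesis using 1(4) by Groebner_Basis.algebra
    qed
    \<comment> \<open>A line through the origin of the (t, s) plane is vertical in the (x, y) plane,
      so the points, not being opposite, would coincide; \<open>tangent\<close> rules this
      out.\<close>
    have \<beta>0: "\<beta> \<noteq> 0"
    proof
      assume "\<beta> = 0"
      then have *: "s1 = \<alpha> * t1" "s2 = \<alpha> * t2" using \<beta>2 by (auto simp: \<beta>_def)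
      then have "\<alpha> \<noteq> 0" using 1 by auto
      then have "x1 = 1 / \<alpha>" "x2 = 1 / \<alpha>" using * 1 2 by (simp_all add: field_simps)
      then have "- 2 * \<alpha> * s1 = 0" using tangent * by simp
      then show False using \<open>\<alpha> \<noteq> 0\<close> 1 by simp
    qed
    define l n where "l = - \<alpha> / \<beta>" and "n = 1 / \<beta>"
    have "x1 = t1 * y1" "s1 * y1 = 1" "x2 = t2 * y2" "s2 * y2 = 1" using 1(1-3) 2(1-3) by simp_all
    then have "\<alpha> * x1 + \<beta> * y1 = 1" "\<alpha> * x2 + \<beta> * y2 = 1"
      using \<beta>_def \<beta>2 by Groebner_Basis.algebra+
    then have y1: "y1 = l * x1 + n" and y2: "y2 = l * x2 + n"
      using \<beta>0 by (simp_all add: l_def n_def field_simps)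
    have slope: "is_slope a x1 y1 x2 y2 l"
    proof (cases "x1 = x2")
      case True
      have "(s1 - \<alpha> * t1) * (3 * t1^2 + a * s1^2) = - 2 * \<alpha> * s1" by (rule tangent[OF True])
      then have *: "\<beta> * (3 * t1^2 + a * s1^2) = - 2 * \<alpha> * s1" by (simp only: \<beta>_def)
      have "l * \<beta> = - \<alpha>" "x1 * s1 = t1" "y1 * s1 = 1" using \<beta>0 1(1-3) by (simp_all add: l_def)
      then have "\<beta> * s1^2 * (l * (2 * y1)) = \<beta> * s1^2 * (3 * x1^2 + a)"
        using * by Groebner_Basis.algebra
      then have "l * (2 * y1) = 3 * x1^2 + a" using \<beta>0 1(3) by simp
      moreover have "y2 = y1" using same[OF True] 1(2) 2(2) by simp
      ultimately show ?thesis using True unfolding is_slope_def by (simp add: power2_eq_square)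
    next
      case False
      have "(x1 - x2) * (l * (y1 + y2)) = (x1 - x2) * (x1^2 + x1 * x2 + x2^2 + a)"
        using curve y1 y2 by Groebner_Basis.algebra
      then have "l * (y1 + y2) = x1^2 + x1 * x2 + x2^2 + a" using False by simp
      then show ?thesis using y1 y2 by (simp add: is_slope_def algebra_simps)
    qed
    define x3 where "x3 = l^2 - x1 - x2"
    define y3 where "y3 = l * x3 + n"
    have y3': "y3 = y1 + l * (x3 - x1)" using y1 by (simp add: y3_def algebra_simps)
    have sum: "P \<oplus>\<^sub>C Q = Affine x3 (- y3)"
      using point_add_short[OF slope nopp] 4 by (simp add: x3_def y3' algebra_simps)
    have curve3: "y3^2 = x3^3 + a * x3 + b"
      by (rule third_point_on_line(1)[OF slope curve(1) x3_def y3'])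
    have e1: "x1 + x2 + x3 = l^2" by (simp add: x3_def)
    have e2: "x1 * x2 + x1 * x3 + x2 * x3 = a - 2 * l * n"
      using slope y1 y2 unfolding is_slope_def x3_def by Groebner_Basis.algebra
    have e3: "x1 * x2 * x3 = n^2 - b"
      using e1 e2 curve(1) y1 by Groebner_Basis.algebra
    \<comment> \<open>The leading coefficient of the cubic in t that results from putting s =
      \<alpha> t + \<beta> into the curve equation. The sum of its roots is obtained from the
      symmetric functions \<open>e1\<close>, \<open>e2\<close>, \<open>e3\<close> of the
      x-coordinates, which count coinciding points correctly.\<close>
    define u where "u = 1 + a * \<alpha>^2 + b * \<alpha>^3"
    have u: "val_unit u"
    proof -
      have "u = 1 + c * (a * c^3 * A^2 + b * c^5 * A^3)"
        unfolding u_def A(2) by Groebner_Basis.algebra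
      also have "val_unit \<dots>"
        using A cV a_in b_in by (intro val_unit_add_ideal val_ideal_mult c) auto
      finally show ?thesis .
    qed
    then have u0: "u \<noteq> 0" by auto
    have "y1 * y2 * y3 = n^3 + a * n * l^2 - b * l^3"
      using e1 e2 e3 y1 y2 y3_def by Groebner_Basis.algebra
    also have "\<dots> = u / \<beta>^3"
      using \<beta>0 by (simp add: n_def l_def u_def field_simps power_numeral_reduce)
    finally have yyy: "y1 * y2 * y3 = u / \<beta>^3" .
    then have y3_0: "y3 \<noteq> 0" using u0 \<beta>0 by auto
    define t3 s3 where "t3 = x3 / y3" and "s3 = 1 / y3"
    have "x1 * y2 * y3 + x2 * y1 * y3 + x3 * y1 * y2 = 2 * a * l * n - 3 * b * l^2"
      using e1 e2 e3 y1 y2 y3_def by Groebner_Basis.algebra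
    also have "\<dots> = - (2 * a * \<alpha> + 3 * b * \<alpha>^2) / \<beta>^2"
      using \<beta>0 by (simp add: n_def l_def field_simps power_numeral_reduce)
    finally have xyy: "x1 * y2 * y3 + x2 * y1 * y3 + x3 * y1 * y2 = - (2 * a * \<alpha> + 3 * b * \<alpha>^2) / \<beta>^2" .
    have y12: "y1 \<noteq> 0" "y2 \<noteq> 0" using 1(2,3) 2(2,3) by auto
    have "x1 / y1 + x2 / y2 + x3 / y3 = (x1 * y2 * y3 + x2 * y1 * y3 + x3 * y1 * y2) / (y1 * y2 * y3)"
      using y12 y3_0 by (simp add: field_simps)
    also have "\<dots> = - (2 * a * \<alpha> + 3 * b * \<alpha>^2) * \<beta> / u"
      unfolding xyy yyy using \<beta>0 u0 by (simp add: field_simps power_numeral_reduce)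
    finally have ttt: "t1 + t2 + t3 = - (2 * a * \<alpha> + 3 * b * \<alpha>^2) * \<beta> / u"
      using 1(1-3) 2(1-3) by (simp add: t3_def)
    define v where "v = (2 * a * A + 3 * b * c^2 * A^2) * c^3 * B / u"
    have v: "v \<in> V" unfolding v_def
      using A B cV a_in b_in by (intro divide_unit_in u) auto
    have "c^2 * v = (2 * a * \<alpha> + 3 * b * \<alpha>^2) * \<beta> / u"
      unfolding v_def A(2) B(2) by (simp add: algebra_simps power_numeral_reduce add_divide_distrib)
    then have "t1 + t2 + t3 = - (c^2 * v)"
      using ttt by (metis minus_divide_left minus_mult_left)
    then have t3: "- t3 = t1 + t2 + c^2 * v" by Groebner_Basis.algebra
    have t3c: "t3 / c \<in> V"
    proof -
      have "t3 = c * - (T1 + T2 + c * v)" using t3 TS(5,6) by Groebner_Basis.algebra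
      then have "t3 / c = - (T1 + T2 + c * v)" using c(2) by simp
      then show ?thesis using TS v cV by simp
    qed
    have s3: "s3 = \<alpha> * t3 + \<beta>"
    proof -
      have "\<alpha> * x3 + \<beta> * y3 = 1" using \<beta>0 by (simp add: y3_def l_def n_def field_simps)
      then show ?thesis using y3_0 by (simp add: s3_def t3_def field_simps)
    qed
    have s3c: "s3 / c^3 \<in> V"
    proof -
      have "s3 / c^3 = A * (t3 / c) + B"
        unfolding s3 A(2) B(2) using c(2) by (simp add: field_simps power_numeral_reduce)
      then show ?thesis using A(1) B(1) t3c by (metis add_in mult_in)
    qed
    have "- s3 = (- t3)^3 + a * (- t3) * (- s3)^2 + b * (- s3)^3"
    proof -
      have "x3 = t3 * y3" "y3 * s3 = 1" using y3_0 by (simp_all add: s3_def t3_def)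
      then have "y3^3 * s3 = y3^3 * (t3^3 + a * t3 * s3^2 + b * s3^3)"
        using curve3 by Groebner_Basis.algebra
      then have "s3 = t3^3 + a * t3 * s3^2 + b * s3^3" using y3_0 by simp
      then show ?thesis by Groebner_Basis.algebra
    qed
    moreover have "x3 = (- t3) / (- s3)" "- y3 = 1 / (- s3)" "- s3 \<noteq> 0"
      using y3_0 by (simp_all add: s3_def t3_def)
    moreover have "- t3 / c \<in> V" "- s3 / c^3 \<in> V"
      using t3c s3c uminus_in by (metis minus_divide_left)+
    ultimately have "P \<oplus>\<^sub>C Q \<in> near_Infinity c"
      unfolding sum near_Infinity_def by blast
    moreover have "parameter (P \<oplus>\<^sub>C Q) = parameter P + parameter Q + c^2 * v"
      using t3 1(1-3) 2(1-3) 4(1,2) unfolding sum by (simp add: t3_def)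
    ultimately show ?thesis using v by blast
  qed (use P Q in \<open>auto intro!: bexI[of _ 0]\<close>)
qed

text \<open>Near infinity s is a unit times t^3. So the scale \<open>c\<close> can be refined to the
  actual size of the parameter, which is needed again after each multiplication by
  \<open>p\<close>.\<close>

lemma near_Infinity_parameter:
  assumes c: "c \<in> val_ideal" "c \<noteq> 0" and P: "P \<in> near_Infinity c" "parameter P \<noteq> 0"
  shows "P \<in> near_Infinity (parameter P)"
proof -
  obtain t s where ts: "P = Affine (t / s) (1 / s)" "s \<noteq> 0" and s: "s = t^3 + a * t * s^2 + b * s^3"
    and tc: "t / c \<in> V" "s / c^3 \<in> V"
    using P by (auto simp: near_Infinity_def)
  have par: "parameter P = t" using ts by simp
  have "t = c * (t / c)" "s = c * (c^2 * (s / c^3))"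
    using c(2) by (simp_all add: power_numeral_reduce)
  then have tm: "t \<in> val_ideal" "s \<in> val_ideal"
    using val_ideal_mult[OF c(1)] tc c(1) by (metis mult_in power_in val_ideal_in)+
  define d where "d = 1 + s * - (a * t + b * s)"
  have d: "val_unit d" unfolding d_def
    using tm a_in b_in by (intro val_unit_add_ideal val_ideal_mult) auto
  have "s * d = t^3" using s unfolding d_def by Groebner_Basis.algebra
  then have "s / t^3 = inverse d" using P(2) par d by (auto simp: field_simps)
  then have "s / t^3 \<in> V" using d by auto
  moreover have "t / t \<in> V" using P(2) par by simp
  ultimately show ?thesis unfolding near_Infinity_def par using ts s by blast
qed

section \<open>Multiples of points near infinity\<close>

abbreviation "G \<equiv> mordell_weil C UNIV"

lemma comm_group_G: "comm_group G"
proof -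
  interpret U: subfield_set "UNIV :: 'a set" by unfold_locales auto
  have "discriminant C = - 16 * (4 * a^3 + 27 * b^2)"
    by (simp add: discriminant_def Let_def power2_eq_square power_numeral_reduce algebra_simps)
  then have "elliptic_curve_over UNIV C"
    using nonsingular by (simp add: elliptic_curve_over_def del: mult_minus_left)
  then show ?thesis by (rule U.comm_group_mordell_weil)
qed

lemma parameter_pow:
  fixes n :: nat
  assumes c: "c \<in> val_ideal" "c \<noteq> 0" and P: "P \<in> near_Infinity c"
  shows "P [^]\<^bsub>G\<^esub> n \<in> near_Infinity c \<and>
    (\<exists>v\<in>V. parameter (P [^]\<^bsub>G\<^esub> n) = of_nat n * parameter P + c^2 * v)"
proof (induction n)
  case 0
  show ?case
    by (auto simp: mordell_weil_def near_Infinity_def nat_pow_def intro!: bexI[of _ 0])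
next
  case (Suc n)
  interpret comm_group G by (rule comm_group_G)
  have PS: "P [^]\<^bsub>G\<^esub> Suc n = P [^]\<^bsub>G\<^esub> n \<oplus>\<^sub>C P"
    by (simp add: mordell_weil_def)
  obtain v where v: "v \<in> V" "parameter (P [^]\<^bsub>G\<^esub> n) = of_nat n * parameter P + c^2 * v"
    using Suc by blast
  obtain w where w: "w \<in> V" "parameter (P [^]\<^bsub>G\<^esub> n \<oplus>\<^sub>C P) = parameter (P [^]\<^bsub>G\<^esub> n) + parameter P + c^2 * w"
    using add_near_Infinity[OF c _ P] Suc by blast
  have "parameter (P [^]\<^bsub>G\<^esub> Suc n) = of_nat (Suc n) * parameter P + c^2 * (v + w)"
    unfolding PS w(2) v(2) by (simp add: algebra_simps)
  moreover have "P [^]\<^bsub>G\<^esub> Suc n \<in> near_Infinity c"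
    unfolding PS using add_near_Infinity[OF c _ P] Suc by blast
  ultimately show ?case using v(1) w(1) by (metis add_in)
qed

text \<open>With c the parameter of \<open>P\<close>, the parameter of n P is c (n + c v), a unit
  times c if \<open>p\<close> does not divide \<open>n\<close>. Otherwise n = p k, and p P again
  satisfies the hypotheses, so the claim for k applies.\<close>

lemma near_Infinity_not_torsion:
  fixes n :: nat
  assumes "n > 0" "P \<in> near_Infinity (parameter P)" "parameter P \<noteq> 0"
    and "parameter P / of_nat p ^ 2 \<in> V"
  shows "P [^]\<^bsub>G\<^esub> n \<noteq> Infinity"
  using assms
proof (induction n arbitrary: P rule: less_induct)
  case (less n)
  interpret comm_group G by (rule comm_group_G)
  define c where "c = parameter P"
  have c: "c \<in> val_ideal" "c \<noteq> 0"
  proof -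
    have "c = of_nat p * (of_nat p * (c / of_nat p ^ 2))" by (simp add: power2_eq_square)
    then show "c \<in> val_ideal"
      using less.prems(4) val_ideal_mult[OF p_in_val_ideal] unfolding c_def by (metis mult_in of_nat_in)
  qed (use less.prems in \<open>simp add: c_def\<close>)
  have P: "P \<in> near_Infinity c" using less.prems by (simp add: c_def)
  show ?case
  proof (cases "p dvd n")
    case False
    obtain v where v: "v \<in> V" "parameter (P [^]\<^bsub>G\<^esub> n) = of_nat n * c + c^2 * v"
      using parameter_pow[OF c P, of n] by (auto simp: c_def)
    have "val_unit (of_int (int n) + c * v)"
      using False v c by (intro val_unit_add_ideal val_unit_of_int val_ideal_mult) auto
    then have "parameter (P [^]\<^bsub>G\<^esub> n) \<noteq> 0"
      unfolding v(2) using c(2) by (auto simp: val_unit_def power2_eq_square algebra_simps simp flip: distrib_left)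
    then show ?thesis by auto
  next
    case True
    then obtain k where k: "n = p * k" by blast
    have "k > 0" "k < n" using less.prems(1) k prime_p prime_gt_1_nat by auto
    obtain v where v: "v \<in> V" "parameter (P [^]\<^bsub>G\<^esub> p) = of_nat p * c + c^2 * v"
      using parameter_pow[OF c P, of p] by (auto simp: c_def)
    \<comment> \<open>The parameter of p P is p c + c^2 v = p c w. Divisibility of c by p^2 makes
      the correction c v / p a nonunit, so that \<open>w\<close> is a unit.\<close>
    define w where "w = 1 + of_nat p * ((c / of_nat p ^ 2) * v)"
    have w: "val_unit w" unfolding w_def
      using less.prems(4) v p_in_val_ideal
      by (intro val_unit_add_ideal val_ideal_mult mult_in) (auto simp: c_def)
    have par: "parameter (P [^]\<^bsub>G\<^esub> p) = of_nat p * c * w"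
      unfolding v(2) w_def by (simp add: field_simps power2_eq_square)
    have near: "P [^]\<^bsub>G\<^esub> p \<in> near_Infinity c" using parameter_pow[OF c P] by blast
    have nz: "parameter (P [^]\<^bsub>G\<^esub> p) \<noteq> 0" unfolding par using c w by auto
    have "parameter (P [^]\<^bsub>G\<^esub> p) / of_nat p ^ 2 = of_nat p * (c / of_nat p ^ 2) * w"
      unfolding par by simp
    also have "\<dots> \<in> V"
      using less.prems(4) w by (intro mult_in of_nat_in) (auto simp: c_def)
    finally have "(P [^]\<^bsub>G\<^esub> p) [^]\<^bsub>G\<^esub> k \<noteq> Infinity"
      using less.IH[OF \<open>k < n\<close> \<open>k > 0\<close> near_Infinity_parameter[OF c near nz] nz] by blast
    moreover have "P \<in> carrier G"
      using near_Infinity_in_pts P by (simp add: mordell_weil_def)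
    ultimately show ?thesis by (simp add: nat_pow_pow k)
  qed
qed

text \<open>Here \<open>x\<close> is a unit over \<open>w\<close> and \<open>y^2\<close> a unit over
  \<open>w^3\<close>, so (x / y)^2 is a unit times \<open>w\<close>. This is why \<open>p^4\<close>
  has to divide \<open>w\<close> for p^2 to divide the parameter.\<close>

lemma unit_pole_not_torsion:
  fixes n :: nat
  assumes y: "y^2 = x^3 + a * x + b" and x: "val_unit (x * w)" and w: "w / of_nat p ^ 4 \<in> V" "w \<noteq> 0"
    and "n > 0"
  shows "Affine x y [^]\<^bsub>G\<^esub> n \<noteq> Infinity"
proof -
  have wm: "w \<in> val_ideal"
  proof -
    have "w = of_nat p * (of_nat p ^ 3 * (w / of_nat p ^ 4))" by (simp add: power_numeral_reduce)
    then show ?thesis using w val_ideal_mult[OF p_in_val_ideal] by (metis mult_in of_nat_in power_in)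
  qed
  have x0: "x \<noteq> 0" using x by auto
  define u where "u = (x * w)^3 + w * (w * (a * (x * w) + b * w))"
  have u: "val_unit u"
    unfolding u_def using x wm a_in b_in
    by (intro val_unit_add_ideal val_unit_power val_ideal_mult) auto
  have yw: "y^2 * w^3 = u" unfolding y u_def by Groebner_Basis.algebra
  then have y0: "y \<noteq> 0" using u by auto
  define t where "t = x / y"
  have "t^2 = w * ((x * w)^2 / u)"
    unfolding t_def yw[symmetric] using y0 w(2) by (simp add: field_simps power_numeral_reduce)
  then have "(t / of_nat p ^ 2)^2 = (w / of_nat p ^ 4) * ((x * w)^2 / u)"
    by (simp add: power_divide flip: power_mult)
  also have "\<dots> \<in> V" using w(1) x u
    by (intro mult_in[OF w(1)] divide_unit_in[OF _ u] power_in) auto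
  finally have tp: "t / of_nat p ^ 2 \<in> V" by (rule square_in_imp_in)
  have par: "parameter (Affine x y) = t" "t \<noteq> 0" using x0 y0 by (simp_all add: t_def)
  have "(1 / y) / t^3 = u / (x * w)^3"
    unfolding t_def yw[symmetric] using y0 x0 w(2) by (simp add: field_simps power_numeral_reduce)
  also have "\<dots> \<in> V" using x u by (intro divide_unit_in val_unit_power) auto
  finally have s: "(1 / y) / t^3 \<in> V" .
  have "Affine x y = Affine (t / (1 / y)) (1 / (1 / y))" using y0 by (simp add: t_def)
  moreover have "1 / y = t^3 + a * t * (1 / y)^2 + b * (1 / y)^3"
  proof -
    have "1 / y = (x^3 + a * x + b) / y^3" unfolding y[symmetric] using y0 by (simp add: power_numeral_reduce)
    also have "\<dots> = t^3 + a * t * (1 / y)^2 + b * (1 / y)^3"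
      unfolding t_def by (simp add: add_divide_distrib power_numeral_reduce)
    finally show ?thesis .
  qed
  moreover have "1 / y \<noteq> 0" "t / t \<in> V" using par y0 by auto
  ultimately have "Affine x y \<in> near_Infinity t"
    unfolding near_Infinity_def using s by blast
  then show ?thesis using near_Infinity_not_torsion[OF \<open>n > 0\<close>] par tp by metis
qed

end

section \<open>Ramification in fields of bounded degree\<close>

text \<open>For \<open>x\<close> outside \<open>V\<close>, the reversed polynomial vanishes at the
  nonunit \<open>inverse x\<close>, which makes its constant term, the leading coefficient of
  \<open>g\<close>, a nonunit.\<close>

lemma valuation_ring_integrally_closed:
  assumes "valuation_ring V p" "\<And>i. coeff g i \<in> V" "valuation_ring.val_unit V (lead_coeff g)" "poly g x = 0"
  shows "x \<in> V"
proof (rule ccontr)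
  interpret valuation_ring V p by fact
  assume x: "x \<notin> V"
  then have y: "inverse x \<in> val_ideal"
    using in_or_inverse_in[of x] by (auto simp: val_ideal_def val_unit_def)
  have "x \<noteq> 0" using x by auto
  then have "poly (reflect_poly g) (inverse x) = 0"
    using assms(4) by (simp add: poly_reflect_poly_nz)
  moreover obtain h where h: "reflect_poly g = pCons (lead_coeff g) h"
    by (metis coeff_0_reflect_poly coeff_pCons_0 pCons_cases)
  ultimately have "lead_coeff g = inverse x * - poly h (inverse x)"
    by (simp add: add_eq_0_iff)
  moreover have "poly h (inverse x) \<in> V"
  proof -
    have "coeff h i = coeff (reflect_poly g) (Suc i)" for i by (simp add: h)
    then have "coeff h i \<in> V" for i using assms(2) by (simp add: coeff_reflect_poly)
    then show ?thesis unfolding poly_altdef using y by (intro sum_in mult_in power_in) auto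
  qed
  ultimately have "lead_coeff g \<in> val_ideal" using val_ideal_mult[OF y] by (metis uminus_in)
  then show False using assms(3) by (simp add: val_ideal_def)
qed

lemma algebraic_nonzero_poly:
  assumes "f \<noteq> 0" "\<And>i. coeff f i \<in> \<int>" "poly f x = 0" "x \<noteq> 0"
  obtains g where "coeff g 0 \<noteq> 0" "\<And>i. coeff g i \<in> \<int>" "poly g x = (0 :: 'a :: field_char_0)"
  using assms
proof (induction f arbitrary: thesis)
  case (pCons c f)
  show ?case
  proof (cases "c = 0")
    case False
    then show ?thesis using pCons.prems by (intro pCons.prems(1)[of "pCons c f"]) auto
  next
    case True
    have "coeff f i \<in> \<int>" for i using pCons.prems(3)[of "Suc i"] by simp
    then show ?thesis using pCons.IH[OF pCons.prems(1)] pCons.prems True by auto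
  qed
qed auto

text \<open>Once \<open>p\<close> exceeds the absolute values of the nonzero integers at both ends
  of a polynomial for \<open>x\<close>, these are units. Then \<open>x\<close> is integral by the
  polynomial, and \<open>inverse x\<close> by its reversal.\<close>

lemma algebraic_eventually_unit:
  fixes x :: "'a :: field_char_0"
  assumes "algebraic x" "x \<noteq> 0"
  obtains N :: nat where "\<And>(V :: 'a set) p. valuation_ring V p \<Longrightarrow> p > N \<Longrightarrow> valuation_ring.val_unit V x"
proof -
  obtain g where g0: "coeff g 0 \<noteq> 0" and gi: "\<And>i. coeff g i \<in> \<int>" and gx: "poly g x = 0"
    using assms algebraic_nonzero_poly unfolding algebraic_def by metis
  have lc: "lead_coeff g \<noteq> 0" using g0 by auto
  obtain m where m: "coeff g 0 = of_int m" using gi by (meson Ints_cases)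
  obtain n where n: "lead_coeff g = of_int n" using gi by (meson Ints_cases)
  have mn0: "m \<noteq> 0" "n \<noteq> 0" using m n g0 lc by auto
  show thesis
  proof (rule that[of "nat \<bar>m\<bar> + nat \<bar>n\<bar>"])
    fix V :: "'a set" and p assume V: "valuation_ring V p" and p: "p > nat \<bar>m\<bar> + nat \<bar>n\<bar>"
    interpret valuation_ring V p by fact
    have "\<not> int p dvd m" "\<not> int p dvd n"
      using mn0 p zdvd_imp_le[of "int p" "\<bar>m\<bar>"] zdvd_imp_le[of "int p" "\<bar>n\<bar>"] by auto
    then have u: "val_unit (coeff g 0)" "val_unit (lead_coeff g)"
      unfolding m n using val_unit_of_int by auto
    have gV: "coeff g i \<in> V" for i using gi[of i] by (auto elim!: Ints_cases)
    have "x \<in> V" by (rule valuation_ring_integrally_closed[OF V gV u(2) gx])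
    moreover have "inverse x \<in> V"
    proof (rule valuation_ring_integrally_closed[OF V])
      show "coeff (reflect_poly g) i \<in> V" for i using gV by (simp add: coeff_reflect_poly)
      have "lead_coeff (reflect_poly g) = coeff g 0"
        using g0 by (simp add: coeff_reflect_poly degree_reflect_poly_eq)
      then show "val_unit (lead_coeff (reflect_poly g))" using u by simp
      show "poly (reflect_poly g) (inverse x) = 0"
        using gx assms(2) by (simp add: poly_reflect_poly_nz)
    qed
    ultimately show "val_unit x" using assms(2) by (simp add: val_unit_def)
  qed
qed

lemma (in valuation_ring) root_in_val_ideal:
  assumes "val_unit (q ^ e / of_nat p)" "e > 0"
  shows "q \<in> val_ideal"
proof -
  have q0: "q \<noteq> 0" using assms by (auto simp: val_unit_def)
  have "inverse q \<notin> V"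
  proof
    assume "inverse q \<in> V"
    then have "inverse q ^ e * (q ^ e / of_nat p) \<in> V"
      using assms(1) by (intro mult_in power_in) (auto simp: val_unit_def)
    moreover have "inverse q ^ e * (q ^ e / of_nat p) = inverse (of_nat p)"
      using q0 by (simp add: power_inverse field_simps)
    ultimately show False using inverse_p_notin by simp
  qed
  then show ?thesis using in_or_inverse_in[of q] by (auto simp: val_ideal_def val_unit_def)
qed

text \<open>A stand-in for the degree over \<rat>: every element has degree at most
  \<open>n\<close>. Integer coefficients allow each one to be split into a power of \<open>p\<close>
  and a unit.\<close>

definition bounded_degree :: "nat \<Rightarrow> 'a :: field_char_0 set \<Rightarrow> bool" where
  "bounded_degree n L \<longleftrightarrow>
     (\<forall>x\<in>L. \<exists>f. f \<noteq> 0 \<and> (\<forall>i. coeff f i \<in> \<int>) \<and> degree f \<le> n \<and> poly f x = 0)"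

lemma bounded_degree_algebraic: "bounded_degree n L \<Longrightarrow> x \<in> L \<Longrightarrow> algebraic x"
  unfolding bounded_degree_def algebraic_def by blast

context valuation_ring begin

lemma zero_in_val_ideal: "0 \<in> val_ideal"
  by (simp add: val_ideal_def val_unit_def)

lemma val_ideal_sum: "(\<And>i. i \<in> I \<Longrightarrow> f i \<in> val_ideal) \<Longrightarrow> sum f I \<in> val_ideal"
  by (induction I rule: infinite_finite_induct) (auto simp: val_ideal_add zero_in_val_ideal)

text \<open>The term with the least exponent dominates: after division by its power of
  \<open>q\<close>, the rest lies in the maximal ideal and cannot cancel a unit.\<close>

lemma sum_distinct_powers_nonzero:
  assumes "finite I" "I \<noteq> {}" "\<And>i. i \<in> I \<Longrightarrow> val_unit (u i)" "inj_on N I"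
    and "q \<in> val_ideal" "q \<noteq> 0"
  shows "(\<Sum>i\<in>I. u i * q ^ N i) \<noteq> 0"
proof -
  obtain k where k: "k \<in> I" "\<And>i. i \<in> I \<Longrightarrow> N k \<le> N i"
    using assms(1,2) by (metis (no_types, lifting) arg_min_if_finite(1) arg_min_least)
  have "u i * q ^ (N i - N k) \<in> val_ideal" if "i \<in> I - {k}" for i
  proof -
    have "N i \<noteq> N k" using that k assms(4) by (auto dest: inj_onD)
    moreover have "N k \<le> N i" using k(2) that by blast
    ultimately have "N i - N k \<noteq> 0" by simp
    then obtain j where "N i - N k = Suc j" using not0_implies_Suc by blast
    then have "u i * q ^ (N i - N k) = q * (u i * q ^ j)" by simp
    moreover have "u i * q ^ j \<in> V"
      using assms(3)[of i] that val_ideal_in[OF assms(5)] by (intro mult_in power_in) (auto simp: val_unit_def)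
    ultimately show ?thesis using val_ideal_mult[OF assms(5)] by metis
  qed
  then have "(\<Sum>i\<in>I - {k}. u i * q ^ (N i - N k)) \<in> val_ideal"
    by (rule val_ideal_sum)
  then have "val_unit (u k + (\<Sum>i\<in>I - {k}. u i * q ^ (N i - N k)))"
    using assms(3) k by (intro val_unit_add_ideal) auto
  moreover have "(\<Sum>i\<in>I. u i * q ^ N i) = q ^ N k * (u k + (\<Sum>i\<in>I - {k}. u i * q ^ (N i - N k)))"
  proof -
    have "(\<Sum>i\<in>I. u i * q ^ N i) = (\<Sum>i\<in>I. q ^ N k * (u i * q ^ (N i - N k)))"
      using k by (intro sum.cong refl) (simp flip: power_add)
    also have "\<dots> = q ^ N k * (\<Sum>i\<in>I. u i * q ^ (N i - N k))"
      by (simp add: sum_distrib_left)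
    also have "(\<Sum>i\<in>I. u i * q ^ (N i - N k)) = u k + (\<Sum>i\<in>I - {k}. u i * q ^ (N i - N k))"
      using assms(1) k by (subst sum.remove[of _ k]) auto
    finally show ?thesis .
  qed
  ultimately show ?thesis using assms(6) by auto
qed

text \<open>If \<open>e > n\<close>, write p as a unit times \<open>q ^ e\<close>. A nonzero term of
  degree i in an equation for \<open>q\<close> is then a unit times a power of \<open>q\<close>
  whose exponent is i modulo \<open>e\<close>. As i \<le> n < e, these exponents are distinct and
  the terms cannot cancel.\<close>

lemma ramification_le_degree:
  assumes "bounded_degree n L" "q \<in> L" "val_unit (q ^ e / of_nat p)" 
  shows "e \<le> n"
proof (rule ccontr)
  assume "\<not> e \<le> n"
  obtain f where f: "f \<noteq> 0" "\<And>i. coeff f i \<in> \<int>" "degree f \<le> n" "poly f q = 0"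
    using assms(1,2) unfolding bounded_degree_def by blast
  have "e > 0" using \<open>\<not> e \<le> n\<close> by simp
  have "q \<noteq> 0" using assms(3) \<open>e > 0\<close> by (auto simp: val_unit_def)
  define w where "w = of_nat p / q ^ e"
  have w: "val_unit w" using val_unit_inverse[OF assms(3)] by (simp add: w_def)
  have p: "of_nat p = w * q ^ e" using \<open>q \<noteq> 0\<close> by (simp add: w_def)
  have q: "q \<in> val_ideal" using root_in_val_ideal[OF assms(3) \<open>e > 0\<close>] .
  define I where "I = {i. coeff f i \<noteq> 0}"
  have I: "finite I" "I \<noteq> {}" and Ie: "\<And>i. i \<in> I \<Longrightarrow> i < e"
    using f \<open>\<not> e \<le> n\<close> unfolding I_def
    by (auto simp: MOST_coeff_eq_0[unfolded MOST_iff_cofinite] poly_eq_iff dest: le_degree)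
  have "\<exists>u a. val_unit u \<and> coeff f i = u * q ^ (a * e)" if "i \<in> I" for i
  proof -
    obtain m where m: "coeff f i = of_int m" using f(2) by (meson Ints_cases)
    then have "m \<noteq> 0" using that by (auto simp: I_def)
    moreover have "\<not> is_unit (int p)" using prime_p by auto
    ultimately obtain m' where m': "m = int p ^ multiplicity (int p) m * m'" "\<not> int p dvd m'"
      using multiplicity_decompose' by metis
    let ?a = "multiplicity (int p) m"
    have "coeff f i = (of_int m' * w ^ ?a) * q ^ (?a * e)"
    proof -
      have "coeff f i = of_nat p ^ ?a * of_int m'" using m m'(1) 
        by (metis of_int_mult of_int_of_nat_eq of_int_power)
      then show ?thesis unfolding p by (simp add: power_mult_distrib mult.commute power_mult)
    qed
    then show ?thesis using val_unit_of_int[OF m'(2)] w val_unit_mult val_unit_power by blast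
  qed
  then obtain u a where ua: "\<And>i. i \<in> I \<Longrightarrow> val_unit (u i) \<and> coeff f i = u i * q ^ (a i * e)" by metis
  have "0 = (\<Sum>i\<le>degree f. coeff f i * q ^ i)" using f(4) by (simp add: poly_altdef)
  also have "\<dots> = (\<Sum>i\<in>I. coeff f i * q ^ i)"
    by (intro sum.mono_neutral_right) (auto simp: I_def intro: le_degree)
  also have "\<dots> = (\<Sum>i\<in>I. u i * q ^ (a i * e + i))"
    using ua by (intro sum.cong refl) (simp add: power_add)
  finally have "(\<Sum>i\<in>I. u i * q ^ (a i * e + i)) = 0" ..
  moreover have "inj_on (\<lambda>i. a i * e + i) I"
  proof (rule inj_onI)
    fix i j assume ij: "i \<in> I" "j \<in> I" "a i * e + i = a j * e + j"
    have "i = (a i * e + i) mod e" "j = (a j * e + j) mod e" using ij(1,2) Ie by simp_all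
    then show "i = j" using ij(3) by metis
  qed
  ultimately show False
    using sum_distinct_powers_nonzero[OF I, of u "\<lambda>i. a i * e + i" q] ua q \<open>q \<noteq> 0\<close> by blast
qed

text \<open>Take the largest \<open>k\<close> such that \<open>p\<close> is a unit times a \<open>2^k\<close>-th power in \<open>L\<close>.\<close>

lemma exists_non_square_element:
  assumes L: "subfield_set L" and deg: "bounded_degree n L"
  obtains q k where "q \<in> L" "q \<noteq> 0" "val_unit (q ^ 2 ^ k / of_nat p)"
    "\<And>r. r \<in> L \<Longrightarrow> \<not> val_unit (q * r^2)"
proof -
  interpret L: subfield_set L by fact
  define S where "S = {k. \<exists>q\<in>L. val_unit (q ^ 2 ^ k / of_nat p)}"
  have "val_unit (of_nat p ^ 2 ^ 0 / of_nat p)" by simp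
  then have "0 \<in> S" unfolding S_def using L.of_nat_in by blast
  moreover have "k \<le> n" if kS: "k \<in> S" for k
  proof -
    obtain q where "q \<in> L" "val_unit (q ^ 2 ^ k / of_nat p)" using kS unfolding S_def by blast
    then have "2 ^ k \<le> n" by (rule ramification_le_degree[OF deg])
    then show ?thesis using less_exp[of k] by linarith
  qed
  then have "finite S" by (meson finite_nat_set_iff_bounded_le)
  ultimately have k: "Max S \<in> S" and max: "\<And>j. j \<in> S \<Longrightarrow> j \<le> Max S"
    using Max_in by auto
  then obtain q where q: "q \<in> L" "val_unit (q ^ 2 ^ Max S / of_nat p)" by (auto simp: S_def)
  have q0: "q \<noteq> 0" using q(2) by (auto simp: val_unit_def)
  \<comment> \<open>If \<open>q * r^2\<close> were a unit, \<open>q\<close> could be replaced by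
    \<open>inverse r\<close> squared, and p would be a unit times a power with twice the
    exponent.\<close>
  have "\<not> val_unit (q * r^2)" if "r \<in> L" for r
  proof
    assume *: "val_unit (q * r^2)"
    have "inverse r ^ (2 * m) / x = (q ^ m / x) * inverse ((q * r^2) ^ m)" for m x
      using q0 by (simp add: power_mult power_mult_distrib power_inverse divide_inverse)
    from this[of "2 ^ Max S" "of_nat p"]
    have "inverse r ^ 2 ^ Suc (Max S) / of_nat p = (q ^ 2 ^ Max S / of_nat p) * inverse ((q * r^2) ^ 2 ^ Max S)"
      by (simp only: power_Suc)
    then have "val_unit (inverse r ^ 2 ^ Suc (Max S) / of_nat p)"
      using val_unit_mult[OF q(2) val_unit_inverse[OF val_unit_power[OF *]]] by (simp only:)
    then have "Suc (Max S) \<in> S" unfolding S_def using that L.inverse_in by blast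
    then show False using max by fastforce
  qed
  then show thesis using that q q0 by blast
qed

end

section \<open>Number fields inside the algebraic closure\<close>

lemma type_ring_simps [simp]:
  "carrier (ring_of_type_algebra :: 'a :: field ring) = UNIV"
  "x \<otimes>\<^bsub>ring_of_type_algebra\<^esub> y = x * (y :: 'a)"
  "x \<oplus>\<^bsub>ring_of_type_algebra\<^esub> y = x + (y :: 'a)"
  "\<one>\<^bsub>ring_of_type_algebra\<^esub> = (1 :: 'a)"
  "\<zero>\<^bsub>ring_of_type_algebra\<^esub> = (0 :: 'a)"
  by (simp_all add: ring_of_type_algebra_def)

lemma type_ring_minus: "\<ominus>\<^bsub>ring_of_type_algebra\<^esub> x = - (x :: 'a :: field)"
proof -
  interpret R: field "ring_of_type_algebra :: 'a ring" by (rule field_from_type_algebra)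
  show ?thesis using R.minus_equality[of "- x" x] by simp
qed

lemma type_ring_inv: "x \<noteq> 0 \<Longrightarrow> inv\<^bsub>ring_of_type_algebra\<^esub> x = inverse (x :: 'a :: field)"
proof -
  interpret R: field "ring_of_type_algebra :: 'a ring" by (rule field_from_type_algebra)
  show "x \<noteq> 0 \<Longrightarrow> inv\<^bsub>ring_of_type_algebra\<^esub> x = inverse x"
    by (intro R.comm_inv_char) auto
qed

lemma type_ring_pow: "x [^]\<^bsub>ring_of_type_algebra\<^esub> (n :: nat) = (x :: 'a :: field) ^ n"
proof -
  interpret R: field "ring_of_type_algebra :: 'a ring" by (rule field_from_type_algebra)
  show ?thesis by (induction n) (simp_all add: mult.commute)
qed

lemma subfield_set_iff:
  fixes F :: "'a :: field_char_0 set"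
  shows "subfield_set F \<longleftrightarrow> subfield F ring_of_type_algebra"
proof -
  interpret R: field "ring_of_type_algebra :: 'a ring" by (rule field_from_type_algebra)
  show ?thesis
  proof
    assume "subfield_set F"
    then interpret subfield_set F .
    show "subfield F ring_of_type_algebra"
      by (intro R.subfieldI' R.subringI) (auto simp: type_ring_minus type_ring_inv)
  next
    assume F: "subfield F ring_of_type_algebra"
    note sub = subringE[OF subfieldE(1)[OF F]]
    show "subfield_set F"
    proof
      fix x y :: 'a
      show "1 \<in> F" using sub(3) by simp
      show "x - y \<in> F" if "x \<in> F" "y \<in> F"
        using sub(7)[OF that(1) sub(5)[OF that(2)]] by (simp add: type_ring_minus)
      show "x * y \<in> F" if "x \<in> F" "y \<in> F" using sub(6)[OF that] by simp
      show "inverse x \<in> F" if "x \<in> F"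
      proof (cases "x = 0")
        case False
        then have "inv\<^bsub>ring_of_type_algebra\<^esub> x \<in> F - {0}"
          using R.subfield_m_inv(1)[OF F, of x] that by simp
        then show ?thesis using False by (simp add: type_ring_inv)
      qed (use that in simp)
    qed
  qed
qed

text \<open>Coefficient lists of \<open>ring.eval\<close> start with the leading coefficient, those
  of \<open>Poly\<close> with the constant one.\<close>

lemma type_ring_eval:
  "ring.eval (ring_of_type_algebra :: 'a :: field ring) ks x = poly (Poly (rev ks)) x"
proof -
  interpret R: field "ring_of_type_algebra :: 'a ring" by (rule field_from_type_algebra)
  show ?thesis
    by (induction ks) (simp_all add: type_ring_pow Poly_append poly_monom)
qed

lemma clear_denominators:
  fixes c :: "nat \<Rightarrow> 'a :: field_char_0"
  assumes "\<And>i. i \<le> n \<Longrightarrow> c i \<in> \<rat>"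
  shows "\<exists>d :: int. d \<noteq> 0 \<and> (\<forall>i\<le>n. of_int d * c i \<in> \<int>)"
  using assms
proof (induction n)
  case 0
  then obtain a b where "b \<noteq> 0" "c 0 = of_int a / of_int b" by (metis Rats_cases' le_refl less_irrefl)
  then show ?case by (auto intro!: exI[of _ b])
next
  case (Suc n)
  then obtain d where d: "d \<noteq> 0" "\<forall>i\<le>n. of_int d * c i \<in> \<int>" by auto
  obtain a b where ab: "b \<noteq> 0" "c (Suc n) = of_int a / of_int b"
    using Suc.prems[of "Suc n"] by (metis Rats_cases' le_refl less_irrefl)
  have "of_int (d * b) * c i \<in> \<int>" if "i \<le> Suc n" for i
  proof (cases "i = Suc n")
    case True
    then have "of_int (d * b) * c i = of_int (d * a)" using ab by simp
    then show ?thesis by (metis Ints_of_int)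
  next
    case False
    then have "of_int d * c i \<in> \<int>" using d(2) that by (simp add: le_Suc_eq)
    then have "of_int b * (of_int d * c i) \<in> \<int>" by (rule Ints_mult[OF Ints_of_int])
    then show ?thesis by (simp add: mult_ac)
  qed
  then show ?case using d ab by (intro exI[of _ "d * b"]) auto
qed

text \<open>In dimension \<open>n\<close> the powers of \<open>x\<close> up to the n-th are linearly
  dependent over \<rat>; clearing denominators gives the integer polynomial.\<close>

lemma finite_dimension_bounded_degree:
  fixes L :: "'a :: field_char_0 set"
  assumes "subfield L ring_of_type_algebra" "ring.finite_dimension ring_of_type_algebra \<rat> L"
  obtains n where "bounded_degree n L"
proof -
  interpret R: field "ring_of_type_algebra :: 'a ring" by (rule field_from_type_algebra)
  interpret L: subfield_set L using assms(1) subfield_set_iff by blast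
  have Q: "subfield \<rat> (ring_of_type_algebra :: 'a ring)"
    unfolding subfield_set_iff[symmetric] by unfold_locales auto
  obtain n where n: "R.dimension n \<rat> L" using assms(2) R.finite_dimension_def by blast
  have "\<exists>f. f \<noteq> 0 \<and> (\<forall>i. coeff f i \<in> \<int>) \<and> degree f \<le> n \<and> poly f x = 0" if x: "x \<in> L" for x
  proof -
    let ?Us = "R.exp_base x (Suc n)"
    have len: "length ?Us = Suc n" by (simp add: R.exp_base_def)
    have set_Us: "set ?Us \<subseteq> L" using x by (auto simp: R.exp_base_def type_ring_pow)
    have dep: "R.dependent \<rat> ?Us"
      using R.independent_length_le_dimension[OF Q n _ set_Us] len by auto
    obtain Ks where Ks: "length Ks = Suc n" "R.combine Ks ?Us = 0" "set Ks \<subseteq> \<rat>" "set Ks \<noteq> {0}"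
      using R.dependent_imp_non_trivial_combine[OF Q _ dep] len by auto
    define g where "g = Poly (rev Ks)"
    have "R.eval Ks x = 0" using R.combine_eq_eval[of Ks x] Ks(1,2) by simp
    then have gx: "poly g x = 0" by (simp add: g_def type_ring_eval)
    have gc: "coeff g i = (if i < Suc n then rev Ks ! i else 0)" for i
      using Ks(1) by (simp add: g_def coeff_Poly_eq nth_default_def)
    have gQ: "coeff g i \<in> \<rat>" for i
    proof (cases "i < Suc n")
      case True
      then have "rev Ks ! i \<in> set (rev Ks)" using Ks(1) by (intro nth_mem) simp
      then show ?thesis using True Ks(3) by (auto simp: gc)
    qed (simp add: gc)
    have g0: "g \<noteq> 0"
    proof
      assume "g = 0"
      then have "rev Ks ! i = 0" if "i < Suc n" for i using gc[of i] that by simp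
      then have "set (rev Ks) \<subseteq> {0}" using Ks(1) by (auto simp: in_set_conv_nth simp del: set_rev)
      moreover have "set Ks \<noteq> {}" using Ks(1) by auto
      ultimately show False using Ks(4) by (metis set_rev subset_singleton_iff)
    qed
    obtain d :: int where d: "d \<noteq> 0" "\<forall>i\<le>n. of_int d * coeff g i \<in> \<int>"
      using clear_denominators[of n "coeff g"] gQ by blast
    have "coeff (smult (of_int d) g) i \<in> \<int>" for i
      using d(2) gc[of i] by (cases "i \<le> n") auto
    moreover have "degree (smult (of_int d) g) \<le> n"
      by (rule degree_le) (simp add: gc)
    ultimately show ?thesis using g0 gx d(1) by (intro exI[of _ "smult (of_int d) g"]) auto
  qed
  then show thesis using that unfolding bounded_degree_def by blast
qed

lemma algebraic_closure_square_root:
  fixes c :: "'a :: field_char_0"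
  assumes "algebraic_closure (ring_of_type_algebra :: 'a ring) K"
  obtains r where "r^2 = c"
proof -
  interpret R: algebraic_closure "ring_of_type_algebra :: 'a ring" K by fact
  let ?f = "[1, 0, - c]"
  have f: "?f \<in> carrier (poly_ring ring_of_type_algebra)"
    by (simp add: univ_poly_def polynomial_def)
  then have "size (R.roots ?f) = 2" using R.roots_over_carrier by (simp add: R.splitted_def)
  then obtain r where "r \<in># R.roots ?f" by fastforce
  then have "R.eval ?f r = 0" using R.roots_mem_iff_is_root[OF f] by (simp add: R.is_root_def)
  then have "r^2 = c" by (simp add: type_ring_eval power2_eq_square)
  then show thesis by (rule that)
qed

text \<open>\<open>L\<close> is obtained from \<open>K\<close> by adjoining the finitely many
  algebraic elements of \<open>A\<close>. It is finite over \<open>K\<close>, hence over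
  \<rat>.\<close>

lemma number_field_extension:
  fixes K :: "'a :: field_char_0 set"
  assumes "number_field K" "algebraic_closure (ring_of_type_algebra :: 'a ring) K"
    and F: "subfield_set F" "K \<subseteq> F" and A: "finite A" "A \<subseteq> F"
  obtains L n where "subfield_set L" "K \<subseteq> L" "A \<subseteq> L" "L \<subseteq> F" "bounded_degree n L"
proof -
  interpret R: algebraic_closure "ring_of_type_algebra :: 'a ring" K by fact
  have K: "subfield K ring_of_type_algebra" and fin: "R.finite_dimension \<rat> K"
    using assms(1) by (auto simp: number_field_def)
  obtain xs where xs: "set xs = A" using A(1) finite_list by blast
  have alg: "(R.algebraic over K) x" for x using R.algebraic_extension by simp
  let ?L = "R.finite_extension K xs"
  have L: "subfield ?L ring_of_type_algebra"
    using R.finite_extension_is_subfield[OF K] alg by simp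
  have Q: "subfield \<rat> (ring_of_type_algebra :: 'a ring)"
    unfolding subfield_set_iff[symmetric] by unfold_locales auto
  have "R.finite_dimension K ?L"
    using R.finite_extension_finite_dimension(1)[OF K] alg by simp
  then have "R.finite_dimension \<rat> ?L" using R.telescopic_base_dim(1)[OF Q K fin] by blast
  then obtain n where "bounded_degree n ?L" using finite_dimension_bounded_degree[OF L] by blast
  moreover have "subfield_set ?L" using L subfield_set_iff by blast
  moreover have "K \<subseteq> ?L" using R.finite_extension_incl[of K xs] by simp
  moreover have "A \<subseteq> ?L" using R.finite_extension_mem[OF subfieldE(1)[OF K], of xs] xs by simp
  moreover have "?L \<subseteq> F"
    using R.finite_extension_subring_incl[of F K xs] F A xs subfieldE(1) subfield_set_iff by blast
  ultimately show thesis by (intro that)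
qed

section \<open>Conjugation over quadratic extensions\<close>

lemma mordell_weil_simps [simp]:
  "carrier (mordell_weil E F) = rational_points E F"
  "P \<otimes>\<^bsub>mordell_weil E F\<^esub> Q = point_add E P Q"
  "\<one>\<^bsub>mordell_weil E F\<^esub> = Infinity"
  by (simp_all add: mordell_weil_def)

lemma inv_mordell_weil:
  assumes "comm_group (mordell_weil E F)" "P \<in> rational_points E F" "point_neg E P \<in> rational_points E F"
  shows "inv\<^bsub>mordell_weil E F\<^esub> P = point_neg E P"
proof -
  interpret comm_group "mordell_weil E F" by fact
  have "point_add E (point_neg E P) P = Infinity" by (cases P) auto
  then show ?thesis using assms(2,3) by (intro inv_equality) auto
qed

lemma (in subfield_set) point_neg_in:
  assumes "elliptic_curve_over F E" "P \<in> rational_points E F"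
  shows "point_neg E P \<in> rational_points E F"
proof (cases P)
  case (Affine x y)
  have "on_curve E x (- y - a1 E * x - a3 E) \<longleftrightarrow> on_curve E x y"
    unfolding on_curve_def by (simp add: algebra_simps power2_eq_square)
  then show ?thesis using assms Affine by (auto simp: rational_points_def elliptic_curve_over_def)
qed (simp add: rational_points_def)

lemma subgroup_mordell_weil:
  assumes "subfield_set F" "subfield_set M" "M \<subseteq> F" "elliptic_curve_over M E"
  shows "subgroup (rational_points E M) (mordell_weil E F)"
proof -
  interpret F: subfield_set F by fact
  interpret M: subfield_set M by fact
  have EF: "elliptic_curve_over F E" using assms(3,4) by (auto simp: elliptic_curve_over_def)
  interpret GM: comm_group "mordell_weil E M" by (rule M.comm_group_mordell_weil) fact
  interpret GF: comm_group "mordell_weil E F" by (rule F.comm_group_mordell_weil) fact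
  have sub: "rational_points E M \<subseteq> rational_points E F" using assms(3) by (auto simp: rational_points_def)
  show ?thesis
  proof
    show "rational_points E M \<subseteq> carrier (mordell_weil E F)" using sub by simp
    show "P \<otimes>\<^bsub>mordell_weil E F\<^esub> Q \<in> rational_points E M"
      if "P \<in> rational_points E M" "Q \<in> rational_points E M" for P Q
      using GM.m_closed that by simp
    show "\<one>\<^bsub>mordell_weil E F\<^esub> \<in> rational_points E M" by (simp add: rational_points_def)
    show "inv\<^bsub>mordell_weil E F\<^esub> P \<in> rational_points E M" if "P \<in> rational_points E M" for P
      using that M.point_neg_in[OF assms(4)] F.point_neg_in[OF EF] sub
        inv_mordell_weil[OF GF.comm_group_axioms] by auto
  qed
qed

lemma (in comm_group) subgroup_finprod_closed:
  assumes "subgroup H G" "finite S" "\<And>x. x \<in> S \<Longrightarrow> f x \<in> H"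
  shows "finprod G f S \<in> H"
  using assms(2,3)
proof (induction S rule: finite_induct)
  case empty
  then show ?case using subgroup.one_closed[OF assms(1)] by simp
next
  case (insert x S)
  then show ?case using subgroup.subset[OF assms(1)] subgroup.m_closed[OF assms(1)]
    by (subst finprod_insert) auto
qed

text \<open>The laws are required on \<open>M\<close> only, since the intended \<open>\<tau>\<close>
  is the conjugation of a quadratic extension, not an automorphism of the closure.\<close>

locale subfield_hom = subfield_set M for M :: "'a :: field_char_0 set" +
  fixes \<tau> :: "'a \<Rightarrow> 'a"
  assumes hom_in: "x \<in> M \<Longrightarrow> \<tau> x \<in> M"
    and hom_one: "\<tau> 1 = 1"
    and hom_diff: "x \<in> M \<Longrightarrow> y \<in> M \<Longrightarrow> \<tau> (x - y) = \<tau> x - \<tau> y"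
    and hom_mult: "x \<in> M \<Longrightarrow> y \<in> M \<Longrightarrow> \<tau> (x * y) = \<tau> x * \<tau> y"
begin

lemma hom_zero: "\<tau> 0 = 0"
  using hom_diff[of 1 1] by simp

lemma hom_uminus: "x \<in> M \<Longrightarrow> \<tau> (- x) = - \<tau> x"
  using hom_diff[of 0 x] hom_zero by simp

lemma hom_add: "x \<in> M \<Longrightarrow> y \<in> M \<Longrightarrow> \<tau> (x + y) = \<tau> x + \<tau> y"
  using hom_diff[of x "- y"] hom_uminus[of y] by simp

lemma hom_power: "x \<in> M \<Longrightarrow> \<tau> (x ^ n) = \<tau> x ^ n"
  by (induction n) (auto simp: hom_one hom_mult)

lemma hom_of_nat: "\<tau> (of_nat n) = of_nat n"
  by (induction n) (auto simp: hom_zero hom_one hom_add)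

lemma hom_numeral: "\<tau> (numeral n) = numeral n"
  using hom_of_nat[of "numeral n"] by simp

lemma hom_eq_0_iff: "x \<in> M \<Longrightarrow> \<tau> x = 0 \<longleftrightarrow> x = 0"
  using hom_mult[of x "inverse x"] hom_zero hom_one by (cases "x = 0") auto

lemma hom_eq_iff: "x \<in> M \<Longrightarrow> y \<in> M \<Longrightarrow> \<tau> x = \<tau> y \<longleftrightarrow> x = y"
  using hom_eq_0_iff[of "x - y"] by (simp add: hom_diff)

lemma hom_divide: "x \<in> M \<Longrightarrow> y \<in> M \<Longrightarrow> \<tau> (x / y) = \<tau> x / \<tau> y"
  using hom_mult[of "x / y" y] hom_eq_0_iff[of y] hom_zero
  by (cases "y = 0") (auto simp: field_simps)

lemmas hom_simps = hom_zero hom_one hom_diff hom_mult hom_uminus hom_add hom_power hom_numeral hom_divide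

fun point_map :: "'a point \<Rightarrow> 'a point" where
  "point_map Infinity = Infinity"
| "point_map (Affine x y) = Affine (\<tau> x) (\<tau> y)"

text \<open>Besides the rational formulas, \<open>\<tau>\<close> has to preserve the case
  distinctions of the addition law; this follows from its injectivity on \<open>M\<close>.\<close>

lemma point_map_add:
  assumes coeffs: "a1 E \<in> M" "a2 E \<in> M" "a3 E \<in> M" "a4 E \<in> M" "a6 E \<in> M"
    and fixed: "\<tau> (a1 E) = a1 E" "\<tau> (a2 E) = a2 E" "\<tau> (a3 E) = a3 E" "\<tau> (a4 E) = a4 E"
    and "P \<in> rational_points E M" "Q \<in> rational_points E M"
  shows "point_map (point_add E P Q) = point_add E (point_map P) (point_map Q)"
proof (cases P; cases Q)
  fix x1 y1 x2 y2
  assume PQ: "P = Affine x1 y1" "Q = Affine x2 y2"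
  then have in_M [simp]: "x1 \<in> M" "y1 \<in> M" "x2 \<in> M" "y2 \<in> M"
    using assms(10,11) by (auto simp: rational_points_def)
  note [simp] = coeffs fixed hom_simps hom_in
  have opp: "\<tau> x1 = \<tau> x2 \<and> \<tau> y1 + \<tau> y2 + a1 E * \<tau> x2 + a3 E = 0 \<longleftrightarrow>
      x1 = x2 \<and> y1 + y2 + a1 E * x2 + a3 E = 0"
    using hom_eq_iff[of x1 x2] hom_eq_0_iff[of "y1 + y2 + a1 E * x2 + a3 E"] by simp
  show "point_map (point_add E P Q) = point_add E (point_map P) (point_map Q)"
  proof (cases "x1 = x2 \<and> y1 + y2 + a1 E * x2 + a3 E = 0")
    case True
    then show ?thesis using opp PQ by simp
  next
    case False
    define l where "l = (if x1 = x2
                then (3 * x1^2 + 2 * a2 E * x1 + a4 E - a1 E * y1) / (2 * y1 + a1 E * x1 + a3 E)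
                else (y2 - y1) / (x2 - x1))"
    have l_in [simp]: "l \<in> M" unfolding l_def by auto
    have l: "\<tau> l = (if \<tau> x1 = \<tau> x2
                then (3 * (\<tau> x1)^2 + 2 * a2 E * \<tau> x1 + a4 E - a1 E * \<tau> y1) / (2 * \<tau> y1 + a1 E * \<tau> x1 + a3 E)
                else (\<tau> y2 - \<tau> y1) / (\<tau> x2 - \<tau> x1))"
      unfolding l_def using hom_eq_iff[of x1 x2] by auto
    define x3 where "x3 = l^2 + a1 E * l - a2 E - x1 - x2"
    have x3_in [simp]: "x3 \<in> M" unfolding x3_def by simp
    have x3: "\<tau> x3 = (\<tau> l)^2 + a1 E * \<tau> l - a2 E - \<tau> x1 - \<tau> x2" unfolding x3_def by simp
    have "point_add E P Q = Affine x3 (- (y1 + l * (x3 - x1)) - a1 E * x3 - a3 E)"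
      unfolding PQ point_add.simps l_def[symmetric] Let_def x3_def[symmetric] using False by auto
    moreover have "point_add E (point_map P) (point_map Q) =
        Affine (\<tau> x3) (- (\<tau> y1 + \<tau> l * (\<tau> x3 - \<tau> x1)) - a1 E * \<tau> x3 - a3 E)"
      unfolding PQ point_map.simps point_add.simps l[symmetric] Let_def x3[symmetric]
      using False opp by auto
    ultimately show ?thesis by simp
  qed
qed auto

end

locale quadratic_extension = subfield_set L for L :: "'a :: field_char_0 set" +
  fixes y :: 'a
  assumes square_in: "y^2 \<in> L" and notin: "y \<notin> L"
begin

definition ext :: "'a set" where "ext = {u + v * y | u v. u \<in> L \<and> v \<in> L}"

text \<open>The choice is determined on \<open>ext\<close>, where the representation is unique, and
  arbitrary elsewhere.\<close>

definition conj :: "'a \<Rightarrow> 'a" where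
  "conj z = (SOME t. \<exists>u\<in>L. \<exists>v\<in>L. z = u + v * y \<and> t = u - v * y)"

lemma representation_unique:
  assumes "u \<in> L" "v \<in> L" "u' \<in> L" "v' \<in> L" "u + v * y = u' + v' * y"
  shows "u = u' \<and> v = v'"
proof -
  have *: "(v - v') * y = u' - u" using assms(5) by (simp add: algebra_simps)
  have "v = v'"
  proof (rule ccontr)
    assume "v \<noteq> v'"
    then have "y = (u' - u) / (v - v')" using * by (simp add: field_simps)
    then show False using notin assms by auto
  qed
  then show ?thesis using assms(5) by simp
qed

lemma conj_eq: "u \<in> L \<Longrightarrow> v \<in> L \<Longrightarrow> conj (u + v * y) = u - v * y"
  unfolding conj_def by (rule some_equality) (use representation_unique in blast)+

lemma ext_I: "u \<in> L \<Longrightarrow> v \<in> L \<Longrightarrow> u + v * y \<in> ext"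
  unfolding ext_def by blast

lemma conj_fixed: "u \<in> L \<Longrightarrow> conj u = u"
  using conj_eq[of u 0] by simp

lemma base_in_ext: "u \<in> L \<Longrightarrow> u \<in> ext"
  using ext_I[of u 0] by simp

lemma root_in_ext: "y \<in> ext"
  using ext_I[of 0 1] by simp

lemma mult_representation:
  "(u + v * y) * (u' + v' * y) = (u * u' + v * v' * y^2) + (u * v' + v * u') * y"
  by (simp add: algebra_simps power2_eq_square)

lemma ext_subfield_hom: "subfield_hom ext conj"
proof
  fix s t :: 'a
  show "1 \<in> ext" by (rule base_in_ext) simp
  show "conj 1 = 1" by (rule conj_fixed) simp
  show "s - t \<in> ext" "conj (s - t) = conj s - conj t" if "s \<in> ext" "t \<in> ext"
  proof -
    obtain u v u' v' where *: "s = u + v * y" "t = u' + v' * y" "u \<in> L" "v \<in> L" "u' \<in> L" "v' \<in> L"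
      using \<open>s \<in> ext\<close> \<open>t \<in> ext\<close> unfolding ext_def by blast
    have st: "s - t = (u - u') + (v - v') * y" using * by (simp add: algebra_simps)
    show "s - t \<in> ext" unfolding st using * by (intro ext_I) auto
    show "conj (s - t) = conj s - conj t"
      using * conj_eq[of "u - u'" "v - v'"] by (simp add: st conj_eq algebra_simps)
  qed
  show "s * t \<in> ext" "conj (s * t) = conj s * conj t" if "s \<in> ext" "t \<in> ext"
  proof -
    obtain u v u' v' where *: "s = u + v * y" "t = u' + v' * y" "u \<in> L" "v \<in> L" "u' \<in> L" "v' \<in> L"
      using \<open>s \<in> ext\<close> \<open>t \<in> ext\<close> unfolding ext_def by blast
    have in_L: "u * u' + v * v' * y^2 \<in> L" "u * v' + v * u' \<in> L" using * square_in by auto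
    show "s * t \<in> ext" unfolding * mult_representation using in_L by (intro ext_I)
    have "conj (s * t) = (u * u' + v * v' * y^2) - (u * v' + v * u') * y"
      unfolding *(1,2) mult_representation by (rule conj_eq[OF in_L])
    also have "\<dots> = (u - v * y) * (u' - v' * y)" by (simp add: algebra_simps power2_eq_square)
    finally show "conj (s * t) = conj s * conj t" using * by (simp add: conj_eq)
  qed
  show "inverse s \<in> ext" if "s \<in> ext"
  proof (cases "s = 0")
    case False
    obtain u v where *: "s = u + v * y" "u \<in> L" "v \<in> L" using \<open>s \<in> ext\<close> unfolding ext_def by blast
    \<comment> \<open>The norm of \<open>s\<close>, by which the inverse is rationalized.\<close>
    define m where "m = u^2 - v^2 * y^2"
    have m: "m \<in> L" using * square_in unfolding m_def by auto
    have "u - v * y \<noteq> 0"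
    proof
      assume "u - v * y = 0"
      then have "u + 0 * y = 0 + v * y" by simp
      then have "u = 0" "v = 0" using representation_unique[of u 0 0 v] * by auto
      then show False using False * by simp
    qed
    moreover have "s * (u - v * y) = m" unfolding * m_def by (simp add: algebra_simps power2_eq_square)
    ultimately have "m \<noteq> 0" "inverse s = (u - v * y) / m"
      using False by (auto simp: field_simps)
    then have "inverse s = u / m + (- v / m) * y" by (simp add: diff_divide_distrib)
    then show ?thesis using * m by (metis divide_in ext_I uminus_in)
  qed (use \<open>s \<in> ext\<close> in simp)
  show "conj s \<in> ext" if "s \<in> ext"
  proof -
    obtain u v where *: "s = u + v * y" "u \<in> L" "v \<in> L" using \<open>s \<in> ext\<close> unfolding ext_def by blast
    then have "conj s = u + (- v) * y" by (simp add: conj_eq)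
    then show ?thesis using * ext_I by (metis uminus_in)
  qed
qed

end

section \<open>Fields with two square classes\<close>

text \<open>Taking norms to the ground field in \<open>(u - \<theta>) (v - \<theta>) (- u - v - \<theta>) = \<alpha> - \<beta> \<theta>\<close>,
  where \<open>\<theta>\<close> is a root of the cubic; there is no \<open>\<theta>^2\<close> on the right because \<open>u\<close>, \<open>v\<close>, \<open>- u - v\<close> sum to \<open>0\<close>.\<close>

lemma cubic_norm_identity:
  fixes a b u v :: "'a :: field"
  assumes "e = - (u^2 + u * v + v^2) - a" "e \<noteq> 0" "z = - u - v" "w = (u * v * z + b) / e"
  shows "(u^3 + a * u + b) * (v^3 + a * v + b) * (z^3 + a * z + b) = e^3 * (w^3 + a * w + b)"
proof -
  have ew: "e * w = u * v * z + b" using assms(2,4) by simp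
  have "e^3 * (w^3 + a * w + b) = (e * w)^3 + a * e^2 * (e * w) + b * e^3"
    by (simp add: algebra_simps power_numeral_reduce)
  also have "\<dots> = (u^3 + a * u + b) * (v^3 + a * v + b) * (z^3 + a * z + b)"
    unfolding ew unfolding assms(1,3) by Groebner_Basis.algebra
  finally show ?thesis ..
qed

definition square_in :: "'a :: field set \<Rightarrow> 'a \<Rightarrow> bool" where
  "square_in F c \<longleftrightarrow> (\<exists>r\<in>F. r^2 = c)"

text \<open>At most two classes are meant: a field in which every element is a square is
  included.\<close>

locale two_square_classes = subfield_set F for F :: "'a :: field_char_0 set" +
  assumes nonsquare_mult:
    "x \<in> F \<Longrightarrow> y \<in> F \<Longrightarrow> \<not> square_in F x \<Longrightarrow> \<not> square_in F y \<Longrightarrow> square_in F (x * y)"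
begin

lemma square_in_mult: "square_in F x \<Longrightarrow> square_in F y \<Longrightarrow> square_in F (x * y)"
  unfolding square_in_def using mult_in power_mult_distrib by metis

lemma square_in_divide: "square_in F x \<Longrightarrow> square_in F y \<Longrightarrow> square_in F (x / y)"
  unfolding square_in_def using divide_in power_divide by metis

lemma square_in_power2: "x \<in> F \<Longrightarrow> square_in F (x^2)"
  unfolding square_in_def by blast

text \<open>If \<open>- 3\<close> is a square, then the form \<open>x^2 + x y + y^2\<close> splits and represents everything.\<close>

lemma exists_nonsquare_form:
  assumes "d \<in> F" "\<not> square_in F d"
  obtains x y where "x \<in> F" "y \<in> F" "x \<noteq> 0" "y \<noteq> 0" "x + y \<noteq> 0"
    "\<not> square_in F (- (x^2 + x * y + y^2))"
proof (cases "square_in F (- 3)")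
  case False
  then show thesis by (intro that[of 1 1]) auto
next
  case True
  then obtain s where s: "s \<in> F" "s^2 = - 3" unfolding square_in_def by blast
  have s0: "s \<noteq> 0" using s by auto
  have d0: "d \<noteq> 0" using assms square_in_power2[of 0] by auto
  \<comment> \<open>Since s^2 = - 3, the equation for the value c reads (2 x + y - s y) (2 x + y + s
    y) = - 4 c. The choice 2 x + y = 1 - c, s y = 1 + c makes the factors - 2 c and 2.\<close>
  define xc where "xc c = (1 - c) / 2 - (1 + c) / (2 * s)" for c
  define yc where "yc c = (1 + c) / s" for c
  have form: "- ((xc c)^2 + xc c * yc c + (yc c)^2) = c" for c
  proof -
    have "2 * s * xc c = s * (1 - c) - (1 + c)" "s * yc c = 1 + c"
      using s0 by (simp_all add: xc_def yc_def field_simps)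
    then have "4 * s^2 * - ((xc c)^2 + xc c * yc c + (yc c)^2) = 4 * s^2 * c"
      using s(2) by Groebner_Basis.algebra
    then show ?thesis using s0 by simp
  qed
  \<comment> \<open>The values of c at which \<open>yc c\<close>, \<open>xc c\<close> or their sum
    vanishes, in this order.\<close>
  define bad where "bad = {- 1, (s - 1) / (s + 1), (1 + s) / (s - 1)}"
  have good: "xc c \<noteq> 0 \<and> yc c \<noteq> 0 \<and> xc c + yc c \<noteq> 0" if "c \<notin> bad" for c
  proof -
    have s1: "s + 1 \<noteq> 0" "s - 1 \<noteq> 0"
    proof -
      show "s + 1 \<noteq> 0"
      proof
        assume "s + 1 = 0"
        then have "s = - 1" by (simp add: eq_neg_iff_add_eq_0)
        then show False using s(2) by simp
      qed
      show "s - 1 \<noteq> 0" using s(2) by auto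
    qed
    have 1: "2 * s * xc c = (s - 1) - c * (s + 1)" "s * yc c = 1 + c"
      "2 * s * (xc c + yc c) = (1 + s) - c * (s - 1)"
      using s0 by (simp_all add: xc_def yc_def field_simps)
    have "c \<noteq> - 1" "c \<noteq> (s - 1) / (s + 1)" "c \<noteq> (1 + s) / (s - 1)"
      using that by (auto simp: bad_def)
    then have "1 + c \<noteq> 0" "(s - 1) - c * (s + 1) \<noteq> 0" "(1 + s) - c * (s - 1) \<noteq> 0"
      using s1 by (auto simp: field_simps add_eq_0_iff)
    then show ?thesis using 1 by (metis mult_zero_right)
  qed
  have "finite bad" by (simp add: bad_def)
  \<comment> \<open>The class of \<open>d\<close> contains infinitely many elements, so one of them
    avoids \<open>bad\<close>; the shift by 1 keeps the square factor nonzero.\<close>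
  moreover have "infinite (range (\<lambda>n :: nat. d * (of_nat n + 1)^2))"
  proof (rule range_inj_infinite, rule injI)
    fix m n :: nat assume "d * (of_nat m + 1)^2 = d * (of_nat n + 1)^2"
    then have "(of_nat ((m + 1)^2) :: 'a) = of_nat ((n + 1)^2)" using d0 by (simp add: algebra_simps)
    then have "(m + 1)^2 = (n + 1)^2" by (simp only: of_nat_eq_iff)
    then show "m = n" by simp
  qed
  ultimately obtain n :: nat where n: "d * (of_nat n + 1)^2 \<notin> bad"
    by (metis (no_types, lifting) finite_subset image_subsetI)
  define c where "c = d * (of_nat n + 1)^2"
  have k0: "(of_nat n + 1 :: 'a) \<noteq> 0" using of_nat_neq_0[of n] by (simp add: add.commute)
  have c: "c \<in> F" using assms unfolding c_def by auto
  have "\<not> square_in F c"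
  proof
    assume "square_in F c"
    then have "square_in F (c / (of_nat n + 1)^2)"
      by (intro square_in_divide square_in_power2) auto
    then show False using assms k0 by (simp add: c_def)
  qed
  moreover have "xc c \<in> F" "yc c \<in> F" using c s unfolding xc_def yc_def by auto
  ultimately show thesis using that[of "xc c" "yc c"] good n form unfolding c_def by metis
qed

text \<open>Four nonsquare values, grouped in pairs, would have a square product. But that product
  is e^3 (f w)^2, which is the nonsquare \<open>d\<close> times the nonzero square of d c^3 f
  w.\<close>

lemma exists_square_cubic_value:
  assumes F: "a \<in> F" "b \<in> F" "u \<in> F" "v \<in> F"
    and "e = - (u^2 + u * v + v^2) - a" "e \<noteq> 0" "z = - u - v" "w = (u * v * z + b) / e"
    and d: "\<not> square_in F d" "e = d * c^2" "c \<in> F" "d \<in> F"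
  shows "\<exists>x\<in>{u, v, z, w}. square_in F (x^3 + a * x + b)"
proof (rule ccontr)
  define f where "f x = x^3 + a * x + b" for x
  assume "\<not> ?thesis"
  then have n: "\<not> square_in F (f u)" "\<not> square_in F (f v)" "\<not> square_in F (f z)" "\<not> square_in F (f w)"
    by (auto simp: f_def)
  have "e \<in> F" using F assms(5) by auto
  then have zw: "z \<in> F" "w \<in> F" using F assms(7,8) by auto
  have f_in: "x \<in> F \<Longrightarrow> f x \<in> F" for x using F by (auto simp: f_def)
  have "square_in F ((f u * f v) * (f z * f w))"
    using n f_in F(3,4) zw
    by (intro square_in_mult[OF nonsquare_mult[of "f u" "f v"] nonsquare_mult[of "f z" "f w"]])
  moreover have "(f u * f v) * (f z * f w) = d * (d * c^3 * f w)^2"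
  proof -
    have "f u * f v * f z = e^3 * f w"
      unfolding f_def by (rule cubic_norm_identity[OF assms(5-8)])
    then show ?thesis unfolding d(2) by Groebner_Basis.algebra
  qed
  moreover have "d * c^3 * f w \<noteq> 0"
  proof -
    have "f w \<noteq> 0" using n(4) square_in_power2[of 0] by auto
    then show ?thesis using assms(6) d(2) by auto
  qed
  moreover have "square_in F ((d * c^3 * f w)^2)"
    using d f_in zw by (intro square_in_power2) auto
  ultimately have "square_in F (d * (d * c^3 * f w)^2 / (d * c^3 * f w)^2)"
    using square_in_divide by metis
  then show False using d(1) \<open>d * c^3 * f w \<noteq> 0\<close> by simp
qed

end

lemma (in integral_short_curve) exists_pole_with_square_value:
  assumes F: "two_square_classes F" and L: "subfield_set L" "L \<subseteq> F" and ab: "a \<in> L" "b \<in> L"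
    and w: "w \<in> L" "w \<in> val_ideal" "w \<noteq> 0"
    and xy: "x0 \<in> L" "y0 \<in> L" "val_unit x0" "val_unit y0" "val_unit (x0 + y0)"
    and d: "d = - (x0^2 + x0 * y0 + y0^2)" "\<not> square_in F d" "val_unit d" and two: "val_unit 2"
  obtains x where "x \<in> L" "val_unit (x * w)" "square_in F (x^3 + a * x + b)"
proof -
  interpret F: two_square_classes F by fact
  interpret L: subfield_set L by fact
  have d0: "d \<noteq> 0" using d(3) by auto
  define k where "k = a / (4 * d)"
  have "val_unit (2 * 2 * d)" using two d(3) val_unit_mult by metis
  then have k: "k \<in> V" unfolding k_def using divide_unit_in[OF a_in] by simp
  have dL: "d \<in> L" using xy unfolding d(1) by simp
  have kL: "k \<in> L" using ab dL unfolding k_def by simp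
  have ka: "a = 4 * d * k" using d0 by (simp add: k_def)
  define m where "m = w * (k * w)"
  have m: "m \<in> val_ideal" unfolding m_def using w k by (intro val_ideal_mult) auto
  have pm: "val_unit (1 + m)" "val_unit (1 - m)"
    using val_unit_add_ideal[OF val_unit_1 m] val_unit_add_ideal[OF val_unit_1 val_ideal_uminus[OF m]]
    by simp_all
  \<comment> \<open>These satisfy g + c = 2 / w and g - c = 2 k w, so that g^2 - c^2 = 4 k = a / d.
    Both are a unit over \<open>w\<close>, because \<open>m = k * w^2\<close> is a nonunit.\<close>
  define c where "c = 1 / w - k * w"
  define g where "g = 1 / w + k * w"
  have cw: "c * w = 1 - m" and gw: "g * w = 1 + m"
    using w(3) by (simp_all add: c_def g_def m_def algebra_simps)
  define u v z where "u = x0 * g" and "v = y0 * g" and "z = - u - v"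
  define e where "e = - (u^2 + u * v + v^2) - a"
  have e: "e = d * c^2"
  proof -
    have "g^2 = c^2 + 4 * k" using w(3) by (simp add: g_def c_def power2_eq_square field_simps)
    moreover have "e = d * g^2 - a" unfolding e_def u_def v_def d(1) by Groebner_Basis.algebra
    ultimately show ?thesis unfolding ka by Groebner_Basis.algebra
  qed
  have c0: "c \<noteq> 0" using cw pm by (auto simp: val_unit_def)
  have e0: "e \<noteq> 0" using e c0 d0 by simp
  define t where "t = (u * v * z + b) / e"
  have gL: "g \<in> L" "c \<in> L" using w kL by (auto simp: g_def c_def)
  have uvL: "u \<in> L" "v \<in> L" "z \<in> L" using gL xy by (auto simp: u_def v_def z_def)
  have tL: "t \<in> L" using uvL ab dL gL unfolding t_def e by auto
  have units: "val_unit (u * w)" "val_unit (v * w)" "val_unit (z * w)" "val_unit (t * w)"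
  proof -
    have uw: "u * w = x0 * (1 + m)" "v * w = y0 * (1 + m)" "z * w = - ((x0 + y0) * (1 + m))"
      unfolding gw[symmetric] by (simp_all add: u_def v_def z_def algebra_simps)
    then show uvz: "val_unit (u * w)" "val_unit (v * w)" "val_unit (z * w)"
      using xy pm by (simp_all add: val_unit_mult val_unit_uminus)
    \<comment> \<open>Scaling by \<open>w\<close> turns the cubic product into a unit and makes
      \<open>b\<close> a small perturbation, while the denominator stays a unit.\<close>
    have "t * w = ((u * w) * (v * w) * (z * w) + w * (b * w^2)) / (d * (c * w)^2)"
      unfolding t_def e using w(3) d0 c0 by (simp add: field_simps power_numeral_reduce)
    moreover have "val_unit ((u * w) * (v * w) * (z * w) + w * (b * w^2))"
      using w b_in by (intro val_unit_add_ideal[OF val_unit_mult[OF val_unit_mult[OF uvz(1,2)] uvz(3)]]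
          val_ideal_mult) auto
    moreover have "val_unit (d * (c * w)^2)"
      unfolding cw using d(3) pm by (intro val_unit_mult val_unit_power)
    ultimately show "val_unit (t * w)" using val_unit_divide by metis
  qed
  have "\<exists>x\<in>{u, v, z, t}. square_in F (x^3 + a * x + b)"
    using F.exists_square_cubic_value[of a b u v e z t d c] e_def e0 z_def t_def d(2) e ab uvL gL dL L(2)
    by blast
  then show thesis using that uvL tL units by blast
qed

section \<open>Infinite rank\<close>

lemma Gal_fixed_field:
  fixes K :: "'a :: field_char_0 set"
  assumes "\<sigma> \<in> Gal K" "algebraic_closure (ring_of_type_algebra :: 'a ring) K"
  shows "two_square_classes (fixed_field \<sigma>)" "K \<subseteq> fixed_field \<sigma>"
proof -
  have hom: "\<sigma> \<in> ring_hom ring_of_type_algebra ring_of_type_algebra"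
    using assms(1) by (simp add: Gal_def ring_iso_def)
  have add: "\<sigma> (x + y) = \<sigma> x + \<sigma> y" and mult: "\<sigma> (x * y) = \<sigma> x * \<sigma> y" and one: "\<sigma> 1 = 1" for x y
    using ring_hom_add[OF hom, of x y] ring_hom_mult[OF hom, of x y] ring_hom_one[OF hom] by simp_all
  have zero: "\<sigma> 0 = 0" using add[of 0 0] by simp
  have uminus: "\<sigma> (- x) = - \<sigma> x" for x
    using add[of x "- x"] zero by (simp add: eq_neg_iff_add_eq_0 add.commute)
  have diff: "\<sigma> (x - y) = \<sigma> x - \<sigma> y" for x y using add[of x "- y"] uminus by simp
  have root: "\<sigma> r = r \<or> \<sigma> r = - r" if "\<sigma> (r^2) = r^2" for r
  proof -
    have "(\<sigma> r)^2 = r^2" using that mult[of r r] by (simp add: power2_eq_square)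
    then show ?thesis by (simp add: power2_eq_iff)
  qed
  show "two_square_classes (fixed_field \<sigma>)"
  proof
    fix x y :: 'a
    show "1 \<in> fixed_field \<sigma>" by (simp add: fixed_field_def one)
    show "x - y \<in> fixed_field \<sigma>" if "x \<in> fixed_field \<sigma>" "y \<in> fixed_field \<sigma>"
      using that by (simp add: fixed_field_def diff)
    show "x * y \<in> fixed_field \<sigma>" if "x \<in> fixed_field \<sigma>" "y \<in> fixed_field \<sigma>"
      using that by (simp add: fixed_field_def mult)
    show "inverse x \<in> fixed_field \<sigma>" if "x \<in> fixed_field \<sigma>"
    proof (cases "x = 0")
      case False
      then have "\<sigma> x * \<sigma> (inverse x) = 1"
        using mult[of x "inverse x"] one by (metis right_inverse)
      moreover have "\<sigma> x = x" using that by (simp add: fixed_field_def)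
      ultimately have "inverse x = \<sigma> (inverse x)" by (metis inverse_unique)
      then show ?thesis unfolding fixed_field_def mem_Collect_eq by (rule sym)
    qed (use that in simp)
    show "square_in (fixed_field \<sigma>) (x * y)"
      if xy: "x \<in> fixed_field \<sigma>" "y \<in> fixed_field \<sigma>"
        and n: "\<not> square_in (fixed_field \<sigma>) x" "\<not> square_in (fixed_field \<sigma>) y"
    proof -
      obtain r s where rs: "r^2 = x" "s^2 = y"
        using algebraic_closure_square_root[OF assms(2)] by metis
      have "\<sigma> (r^2) = r^2" "\<sigma> (s^2) = s^2" unfolding rs using xy by (simp_all add: fixed_field_def)
      moreover have "r \<notin> fixed_field \<sigma>" "s \<notin> fixed_field \<sigma>"
        using n rs unfolding square_in_def by blast+
      ultimately have "\<sigma> r = - r" "\<sigma> s = - s"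
        using root unfolding fixed_field_def mem_Collect_eq by blast+
      then have "r * s \<in> fixed_field \<sigma>" by (simp add: fixed_field_def mult)
      moreover have "(r * s)^2 = x * y" using rs by (simp add: power_mult_distrib)
      ultimately show ?thesis unfolding square_in_def by blast
    qed
  qed
  show "K \<subseteq> fixed_field \<sigma>" using assms(1) by (auto simp: Gal_def fixed_field_def)
qed

section \<open>Choice of the prime and construction of a new point\<close>

lemma algebraic_set_eventually_unit:
  fixes B :: "'a :: field_char_0 set"
  assumes "finite B" "\<And>x. x \<in> B \<Longrightarrow> algebraic x"
  shows "\<exists>N :: nat. \<forall>(V :: 'a set) p. valuation_ring V p \<longrightarrow> p > N \<longrightarrow>
           (\<forall>x\<in>B. x = 0 \<or> valuation_ring.val_unit V x)"
  using assms
proof (induction B rule: finite_induct)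
  case (insert x B)
  obtain N :: nat where N: "\<And>(V :: 'a set) p. valuation_ring V p \<Longrightarrow> p > N \<Longrightarrow> \<forall>x\<in>B. x = 0 \<or> valuation_ring.val_unit V x"
    using insert by blast
  obtain M :: nat where M: "\<And>(V :: 'a set) p. valuation_ring V p \<Longrightarrow> p > M \<Longrightarrow> x = 0 \<or> valuation_ring.val_unit V x"
  proof (cases "x = 0")
    case False
    have "algebraic x" using insert.prems by simp
    then obtain M :: nat where "\<And>(V :: 'a set) p. valuation_ring V p \<Longrightarrow> p > M \<Longrightarrow> valuation_ring.val_unit V x"
      using False by (rule algebraic_eventually_unit) blast
    then show thesis by (intro that[of M]) auto
  qed (use that in simp)
  show ?case
    by (rule exI[of _ "max N M"]) (use N M in auto)
qed auto

lemma (in integral_short_curve) exists_pole_point: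
  assumes F: "two_square_classes F" and L: "subfield_set L" "L \<subseteq> F" "bounded_degree n L"
    and ab: "a \<in> L" "b \<in> L" and two: "val_unit 2"
    and form: "(\<forall>x\<in>F. square_in F x) \<or>
      (\<exists>x0\<in>L. \<exists>y0\<in>L. val_unit x0 \<and> val_unit y0 \<and> val_unit (x0 + y0) \<and>
        val_unit (- (x0^2 + x0 * y0 + y0^2)) \<and> \<not> square_in F (- (x0^2 + x0 * y0 + y0^2)))"
  obtains x y where "x \<in> L" "y \<in> F" "y \<notin> L" "y^2 = x^3 + a * x + b"
    "\<And>k :: nat. k > 0 \<Longrightarrow> Affine x y [^]\<^bsub>G\<^esub> k \<noteq> Infinity"
proof -
  interpret F: two_square_classes F by fact
  interpret L: subfield_set L by fact
  obtain q k where q: "q \<in> L" "q \<noteq> 0" "val_unit (q ^ 2 ^ k / of_nat p)"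
    and nonsq: "\<And>r. r \<in> L \<Longrightarrow> \<not> val_unit (q * r^2)"
    by (rule exists_non_square_element[OF L(1,3)]) blast
  \<comment> \<open>As \<open>q ^ 2 ^ k\<close> is a unit times p, the square
    \<open>(q ^ i)^2\<close> is a unit times p^4. Thus \<open>w\<close> is divisible by p^4 and
    still has the class of \<open>q\<close> modulo squares.\<close>
  define i :: nat where "i = 2 * 2 ^ k"
  define w where "w = q * (q ^ i)^2"
  have qm: "q \<in> val_ideal" using root_in_val_ideal[OF q(3)] by simp
  have w: "w \<in> L" "w \<in> val_ideal" "w \<noteq> 0"
    unfolding w_def using q qm by (auto intro!: val_ideal_mult)
  have "w / of_nat p ^ 4 = q * (q ^ 2 ^ k / of_nat p) ^ 4"
    by (simp add: w_def i_def power_divide flip: power_mult)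
      (simp add: mult.commute)
  also have "\<dots> \<in> V" using q(3) qm by auto
  finally have wp: "w / of_nat p ^ 4 \<in> V" .
  obtain x where x: "x \<in> L" "val_unit (x * w)" "square_in F (x^3 + a * x + b)"
    using form
  proof
    assume sq: "\<forall>x\<in>F. square_in F x"
    have "1 / w \<in> L" using w by auto
    then have "(1 / w)^3 + a * (1 / w) + b \<in> F" using ab L(2) by (meson L.add_in L.mult_in L.power_in subsetD)
    then show thesis using that[of "1 / w"] sq w \<open>1 / w \<in> L\<close> by simp
  next
    assume "\<exists>x0\<in>L. \<exists>y0\<in>L. val_unit x0 \<and> val_unit y0 \<and> val_unit (x0 + y0) \<and>
        val_unit (- (x0^2 + x0 * y0 + y0^2)) \<and> \<not> square_in F (- (x0^2 + x0 * y0 + y0^2))"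
    then obtain x0 y0 where *: "x0 \<in> L" "y0 \<in> L" "val_unit x0" "val_unit y0" "val_unit (x0 + y0)"
        "val_unit (- (x0^2 + x0 * y0 + y0^2))" "\<not> square_in F (- (x0^2 + x0 * y0 + y0^2))" by blast
    show thesis
      by (rule exists_pole_with_square_value[OF F L(1,2) ab w *(1-5) refl *(7,6) two]) (rule that)
  qed
  then obtain y where y: "y \<in> F" "y^2 = x^3 + a * x + b" unfolding square_in_def by blast
  have "y \<notin> L"
  proof
    assume yL: "y \<in> L"
    \<comment> \<open>\<open>w^3\<close> is \<open>q\<close> times the square of
      \<open>w * q ^ i\<close>. As \<open>y^2 * w^3\<close> is a unit, \<open>y\<close> in
      \<open>L\<close> would contradict \<open>nonsq\<close>.\<close>
    have "q * (y * (w * q ^ i))^2 = y^2 * w^3"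
      unfolding w_def by Groebner_Basis.algebra
    also have "\<dots> = (x * w)^3 + w * (w * (a * (x * w) + b * w))"
      unfolding y(2) by Groebner_Basis.algebra
    also have "val_unit \<dots>"
      using x w a_in b_in
      by (intro val_unit_add_ideal val_unit_power val_ideal_mult) auto
    finally show False using nonsq[of "y * (w * q ^ i)"] yL w q by blast
  qed
  moreover have "Affine x y [^]\<^bsub>G\<^esub> k \<noteq> Infinity" if "k > 0" for k :: nat
    by (rule unit_pole_not_torsion[OF y(2) x(2) wp w(3) that])
  ultimately show thesis using that x(1) y by blast
qed

lemma to_short_pow:
  fixes E :: "'a :: field_char_0 weierstrass"
  assumes "comm_group (mordell_weil E F)" "P \<in> rational_points E F"
  shows "to_short E (P [^]\<^bsub>mordell_weil E F\<^esub> (n :: nat)) =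
    to_short E P [^]\<^bsub>mordell_weil (short_weierstrass (short_a E) (short_b E)) UNIV\<^esub> n"
proof (induction n)
  case (Suc n)
  interpret comm_group "mordell_weil E F" by fact
  have "P [^]\<^bsub>mordell_weil E F\<^esub> n \<in> rational_points E F" using assms(2) nat_pow_closed by simp
  then show ?case using Suc to_short_add[of "P [^]\<^bsub>mordell_weil E F\<^esub> n" E P] assms(2)
    by (auto simp: rational_points_def)
qed simp

text \<open>The order of choices matters: the numbers \<open>x0\<close>, \<open>y0\<close> come
  before \<open>L\<close>, which has to contain them, and the prime is chosen afterwards.\<close>

lemma extend_independent:
  fixes K :: "'a :: field_char_0 set"
  assumes K: "number_field K" "algebraic_closure (ring_of_type_algebra :: 'a ring) K"
    and E: "elliptic_curve_over K E" and \<sigma>: "\<sigma> \<in> Gal K"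
    and S: "int_independent (mordell_weil E (fixed_field \<sigma>)) S"
  obtains Q where "Q \<notin> S" "int_independent (mordell_weil E (fixed_field \<sigma>)) (insert Q S)"
proof -
  define F where "F = fixed_field \<sigma>"
  interpret F: two_square_classes F unfolding F_def by (rule Gal_fixed_field[OF \<sigma> K(2)])
  have KF: "K \<subseteq> F" unfolding F_def by (rule Gal_fixed_field[OF \<sigma> K(2)])
  have K_sub: "subfield_set K" using K(1) by (simp add: number_field_def subfield_set_iff)
  interpret K: subfield_set K by fact
  have EF: "elliptic_curve_over F E" using E KF by (auto simp: elliptic_curve_over_def)
  let ?GF = "mordell_weil E F"
  interpret GF: comm_group ?GF by (rule F.comm_group_mordell_weil[OF EF])
  have S: "finite S" "S \<subseteq> rational_points E F"
    and indep: "\<And>c :: 'a point \<Rightarrow> int. (\<Otimes>\<^bsub>?GF\<^esub>x\<in>S. x [^]\<^bsub>?GF\<^esub> c x) = Infinity \<Longrightarrow> \<forall>x\<in>S. c x = 0"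
    using S unfolding int_independent_def F_def by auto
  obtain B where B: "finite B" "B \<subseteq> F" "(\<forall>x\<in>F. square_in F x) \<or>
      (\<exists>x0\<in>B. \<exists>y0\<in>B. x0 \<noteq> 0 \<and> y0 \<noteq> 0 \<and> x0 + y0 \<noteq> 0 \<and> \<not> square_in F (- (x0^2 + x0 * y0 + y0^2)))"
  proof (cases "\<forall>x\<in>F. square_in F x")
    case False
    then obtain d where "d \<in> F" "\<not> square_in F d" by blast
    then obtain x0 y0 where "x0 \<in> F" "y0 \<in> F" "x0 \<noteq> 0" "y0 \<noteq> 0" "x0 + y0 \<noteq> 0"
        "\<not> square_in F (- (x0^2 + x0 * y0 + y0^2))"
      by (rule F.exists_nonsquare_form)
    then show thesis by (intro that[of "{x0, y0}"]) auto
  qed (use that[of "{}"] in auto)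
  define A where "A = (\<Union>P\<in>S. set_point P) \<union> B"
  have "finite (set_point P)" for P :: "'a point" by (cases P) auto
  then have A: "finite A" "A \<subseteq> F"
    using S B by (auto simp: A_def rational_points_def)
  obtain L n where L: "subfield_set L" "K \<subseteq> L" "A \<subseteq> L" "L \<subseteq> F" "bounded_degree n L"
    by (rule number_field_extension[OF K F.subfield_set_axioms KF A])
  interpret L: subfield_set L by fact
  have EL: "elliptic_curve_over L E" using E L by (auto simp: elliptic_curve_over_def)
  have coeffs: "a1 E \<in> L" "a2 E \<in> L" "a3 E \<in> L" "a4 E \<in> L" "a6 E \<in> L"
    using EL by (auto simp: elliptic_curve_over_def)
  have SL: "S \<subseteq> rational_points E L"
  proof
    fix P assume P: "P \<in> S"
    then have "set_point P \<subseteq> L" using L(3) by (auto simp: A_def)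
    then show "P \<in> rational_points E L"
      using P S(2) by (cases P) (auto simp: rational_points_def)
  qed
  define a b where "a = short_a E" and "b = short_b E"
  have ab: "a \<in> L" "b \<in> L" using coeffs by (auto simp: a_def b_def short_a_def short_b_def)
  \<comment> \<open>Everything whose nonzero elements have to be units at \<open>p\<close>: the
    coefficients, 2, and whatever \<open>x0\<close>, \<open>y0\<close> contribute, including the
    value of the form at them.\<close>
  define D where "D = {a, b, 2} \<union> B \<union> {x + y | x y. x \<in> B \<and> y \<in> B} \<union>
    {- (x^2 + x * y + y^2) | x y. x \<in> B \<and> y \<in> B}"
  have BL: "B \<subseteq> L" using L(3) by (simp add: A_def)
  have "finite D" unfolding D_def using B(1) by (simp add: finite_image_set2)
  moreover have "D \<subseteq> L"
  proof -
    have "x + y \<in> L" "- (x^2 + x * y + y^2) \<in> L" if "x \<in> B" "y \<in> B" for x y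
      using subsetD[OF BL that(1)] subsetD[OF BL that(2)]
      by (auto simp del: minus_add_distrib)
    then show ?thesis unfolding D_def using BL ab L.numeral_in by blast
  qed
  then have "algebraic x" if "x \<in> D" for x using bounded_degree_algebraic[OF L(5)] that by blast
  ultimately obtain N :: nat where N: "\<And>(V :: 'a set) p x. valuation_ring V p \<Longrightarrow> p > N \<Longrightarrow> x \<in> D \<Longrightarrow>
      x = 0 \<or> valuation_ring.val_unit V x"
    using algebraic_set_eventually_unit[of D] by metis
  obtain p where p: "prime p" "p > N" using bigger_prime by blast
  obtain V :: "'a set" where V: "valuation_ring V p" using exists_valuation_ring[OF p(1)] by blast
  interpret V: valuation_ring V p by fact
  have unit: "V.val_unit x" if "x \<in> D" "x \<noteq> 0" for x using N[OF V p(2)] that by blast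
  have "4 * a^3 + 27 * b^2 \<noteq> 0"
    using E discriminant_short[of E] unfolding elliptic_curve_over_def a_def b_def
    by (metis mult_zero_right)
  moreover have "x \<in> V" if "x \<in> D" for x using unit[OF that] V.zero_in by blast
  then have "a \<in> V" "b \<in> V" by (simp_all add: D_def)
  ultimately interpret C: integral_short_curve a b V p by unfold_locales
  have form: "(\<forall>x\<in>F. square_in F x) \<or>
      (\<exists>x0\<in>L. \<exists>y0\<in>L. V.val_unit x0 \<and> V.val_unit y0 \<and> V.val_unit (x0 + y0) \<and>
        V.val_unit (- (x0^2 + x0 * y0 + y0^2)) \<and> \<not> square_in F (- (x0^2 + x0 * y0 + y0^2)))"
    using B(3)
  proof
    assume "\<exists>x0\<in>B. \<exists>y0\<in>B. x0 \<noteq> 0 \<and> y0 \<noteq> 0 \<and> x0 + y0 \<noteq> 0 \<and> \<not> square_in F (- (x0^2 + x0 * y0 + y0^2))"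
    then obtain x0 y0 where *: "x0 \<in> B" "y0 \<in> B" "x0 \<noteq> 0" "y0 \<noteq> 0" "x0 + y0 \<noteq> 0"
      and nsq: "\<not> square_in F (- (x0^2 + x0 * y0 + y0^2))" by blast
    have "- (x0^2 + x0 * y0 + y0^2) \<noteq> 0"
      using nsq F.square_in_power2[of 0] by (metis F.zero_in zero_power2)
    moreover have "x0 \<in> D" "y0 \<in> D" "x0 + y0 \<in> D" "- (x0^2 + x0 * y0 + y0^2) \<in> D"
      unfolding D_def using * by blast+
    ultimately have "V.val_unit x0" "V.val_unit y0" "V.val_unit (x0 + y0)" "V.val_unit (- (x0^2 + x0 * y0 + y0^2))"
      using unit * by blast+
    then show ?thesis using * nsq BL by blast
  qed simp
  have two: "V.val_unit 2" by (rule unit) (auto simp: D_def)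
  obtain x y where x: "x \<in> L" and y: "y \<in> F" "y \<notin> L" "y^2 = x^3 + a * x + b"
    and nontors: "\<And>k :: nat. k > 0 \<Longrightarrow> Affine x y [^]\<^bsub>C.G\<^esub> k \<noteq> Infinity"
    by (rule C.exists_pole_point[OF F.two_square_classes_axioms L(1,4,5) ab two form]) blast
  define x' where "x' = x - ((a1 E)^2 + 4 * a2 E) / 12"
  define y' where "y' = y - (a1 E * x' + a3 E) / 2"
  define Q where "Q = Affine x' y'"
  have Qs: "to_short E Q = Affine x y" by (simp add: Q_def x'_def y'_def)
  have x'L: "x' \<in> L" using x coeffs by (simp add: x'_def)
  have curve: "on_curve E x' y'"
  proof -
    have "on_curve (short_weierstrass (short_a E) (short_b E)) x y"
      using y(3) by (simp add: on_curve_short a_def b_def)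
    then show ?thesis using on_curve_to_short[of E x' y'] by (simp add: x'_def y'_def)
  qed
  have "y' \<in> F" using y x'L coeffs L(4) unfolding y'_def by (intro F.diff_in) auto
  then have QF: "Q \<in> rational_points E F"
    using x'L L(4) curve by (auto simp: Q_def rational_points_def)
  have Q_pow: "Q [^]\<^bsub>?GF\<^esub> k \<noteq> Infinity" if "k > 0" for k :: nat
    using to_short_pow[OF GF.comm_group_axioms QF, of k] nontors[OF that] Qs
    by (auto simp: a_def b_def)
  interpret ext: quadratic_extension L y
    using x y ab by unfold_locales auto
  interpret \<tau>: subfield_hom ext.ext ext.conj by (rule ext.ext_subfield_hom)
  have extF: "ext.ext \<subseteq> F" unfolding ext.ext_def using L(4) y(1) by auto
  have EM: "elliptic_curve_over ext.ext E"
    using EL ext.base_in_ext by (auto simp: elliptic_curve_over_def)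
  have QM: "Q \<in> rational_points E ext.ext"
  proof -
    have "y' \<in> ext.ext" unfolding y'_def
      using ext.root_in_ext ext.base_in_ext x'L coeffs by (intro \<tau>.diff_in) auto
    then show ?thesis using curve ext.base_in_ext[OF x'L] by (simp add: Q_def rational_points_def)
  qed
  have subM: "subgroup (rational_points E ext.ext) ?GF"
    by (rule subgroup_mordell_weil[OF F.subfield_set_axioms \<tau>.subfield_set_axioms extF EM])
  have subL: "subgroup (rational_points E L) ?GF"
    by (rule subgroup_mordell_weil[OF F.subfield_set_axioms L(1,4) EL])
  have conj_Q: "\<tau>.point_map Q = inv\<^bsub>?GF\<^esub> Q"
  proof -
    have "ext.conj y' = - y - (a1 E * x' + a3 E) / 2"
      using ext.conj_eq[of "- ((a1 E * x' + a3 E) / 2)" 1] x'L coeffs by (simp add: y'_def)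
    also have "\<dots> = - y' - a1 E * x' - a3 E" by (simp add: y'_def field_simps)
    finally have "\<tau>.point_map Q = point_neg E Q" using ext.conj_fixed[OF x'L] by (simp add: Q_def)
    then show ?thesis using inv_mordell_weil[OF GF.comm_group_axioms QF F.point_neg_in[OF EF QF]] by simp
  qed
  have conj_pow: "\<tau>.point_map (Q [^]\<^bsub>?GF\<^esub> k) = inv\<^bsub>?GF\<^esub> Q [^]\<^bsub>?GF\<^esub> k" for k :: nat
  proof (induction k)
    case (Suc k)
    have "Q [^]\<^bsub>?GF\<^esub> k \<in> rational_points E ext.ext"
      using QM subM by (metis GF.nat_pow_closed GF.subgroup_int_pow_closed int_pow_int)
    then have "\<tau>.point_map (point_add E (Q [^]\<^bsub>?GF\<^esub> k) Q) =
        point_add E (\<tau>.point_map (Q [^]\<^bsub>?GF\<^esub> k)) (\<tau>.point_map Q)"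
      using QM coeffs ext.base_in_ext ext.conj_fixed by (intro \<tau>.point_map_add) auto
    then show ?case using Suc conj_Q by simp
  qed simp
  have fixed: "\<tau>.point_map P = P" if "P \<in> rational_points E L" for P
    using that ext.conj_fixed by (auto simp: rational_points_def)
  \<comment> \<open>A multiple of \<open>Q\<close> in E(L) is both fixed and inverted by
    conjugation, so twice that multiple would vanish.\<close>
  have not_in_L: "Q [^]\<^bsub>?GF\<^esub> k \<notin> rational_points E L" if "k > 0" for k :: nat
  proof
    assume "Q [^]\<^bsub>?GF\<^esub> k \<in> rational_points E L"
    then have "Q [^]\<^bsub>?GF\<^esub> k = inv\<^bsub>?GF\<^esub> Q [^]\<^bsub>?GF\<^esub> k" using fixed conj_pow by metis
    then have "Q [^]\<^bsub>?GF\<^esub> k = inv\<^bsub>?GF\<^esub> (Q [^]\<^bsub>?GF\<^esub> k)" using QF by (simp add: GF.nat_pow_inv)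
    then have "Q [^]\<^bsub>?GF\<^esub> k \<otimes>\<^bsub>?GF\<^esub> Q [^]\<^bsub>?GF\<^esub> k = \<one>\<^bsub>?GF\<^esub>"
      using QF GF.r_inv GF.nat_pow_closed by (metis mordell_weil_simps(1))
    then have "Q [^]\<^bsub>?GF\<^esub> (k + k) = Infinity" using QF GF.nat_pow_mult[of Q k k] by simp
    then show False using Q_pow[of "k + k"] that by simp
  qed
  have QS: "Q \<notin> S"
    using not_in_L[of 1] SL QF GF.nat_pow_eone[of Q] by auto
  moreover have "int_independent ?GF (insert Q S)"
    unfolding int_independent_def
  proof (intro conjI allI impI)
    fix c :: "'a point \<Rightarrow> int"
    assume rel: "(\<Otimes>\<^bsub>?GF\<^esub>x\<in>insert Q S. x [^]\<^bsub>?GF\<^esub> c x) = \<one>\<^bsub>?GF\<^esub>"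
    define P where "P = (\<Otimes>\<^bsub>?GF\<^esub>x\<in>S. x [^]\<^bsub>?GF\<^esub> c x)"
    have PL: "P \<in> rational_points E L" unfolding P_def
      using SL by (intro GF.subgroup_finprod_closed[OF subL S(1)] GF.subgroup_int_pow_closed[OF subL]) auto
    then have PF: "P \<in> carrier ?GF" using subgroup.subset[OF subL] by blast
    have QcF: "Q [^]\<^bsub>?GF\<^esub> c Q \<in> carrier ?GF" using QF by (intro GF.int_pow_closed) simp
    have rel': "Q [^]\<^bsub>?GF\<^esub> c Q \<otimes>\<^bsub>?GF\<^esub> P = \<one>\<^bsub>?GF\<^esub>"
    proof -
      have "(\<lambda>x. x [^]\<^bsub>?GF\<^esub> c x) \<in> S \<rightarrow> carrier ?GF" 
        using S(2) GF.int_pow_closed by (auto simp del: mordell_weil_simps(1) simp flip: mordell_weil_simps(1))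
      from GF.finprod_insert[OF S(1) QS this QcF] rel show ?thesis unfolding P_def by (simp only:)
    qed
    \<comment> \<open>The relation exhibits this multiple of \<open>Q\<close> as the inverse of a
      combination of points of \<open>S\<close>, all of which lie in E(L).\<close>
    have Qc: "Q [^]\<^bsub>?GF\<^esub> c Q \<in> rational_points E L"
      using GF.inv_equality[OF rel' PF QcF] subgroup.m_inv_closed[OF subL PL] by simp
    have "c Q = 0"
    proof (rule ccontr)
      assume "c Q \<noteq> 0"
      then have k: "nat \<bar>c Q\<bar> > 0" by simp
      have "Q [^]\<^bsub>?GF\<^esub> nat \<bar>c Q\<bar> \<in> rational_points E L"
      proof (cases "c Q" rule: int_cases2)
        case (nonneg m)
        then show ?thesis using Qc int_pow_int[of ?GF Q m] by (simp only: abs_of_nat nat_int)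
      next
        case (nonpos m)
        have Qm: "Q [^]\<^bsub>?GF\<^esub> m \<in> carrier ?GF" using QF by (intro GF.nat_pow_closed) simp
        have "Q [^]\<^bsub>?GF\<^esub> c Q = inv\<^bsub>?GF\<^esub> (Q [^]\<^bsub>?GF\<^esub> m)"
          using GF.int_pow_neg_int[of Q m] QF nonpos by (simp only: mordell_weil_simps(1))
        then have "inv\<^bsub>?GF\<^esub> (inv\<^bsub>?GF\<^esub> (Q [^]\<^bsub>?GF\<^esub> m)) \<in> rational_points E L"
          using subgroup.m_inv_closed[OF subL Qc] by (simp only:)
        then show ?thesis using GF.inv_inv[OF Qm] nonpos by (simp only: abs_minus_cancel abs_of_nat nat_int)
      qed
      then show False using not_in_L[OF k] by blast
    qed
    moreover have "P = Infinity" using rel' \<open>c Q = 0\<close> PF by simp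
    then have "\<forall>x\<in>S. c x = 0" using indep unfolding P_def by blast
    ultimately show "\<forall>x\<in>insert Q S. c x = 0" by blast
  qed (use S QF in auto)
  ultimately show thesis using that unfolding F_def by blast
qed

theorem theorem3p11:
  fixes K :: "'a :: field_char_0 set"
    and E :: "'a weierstrass"
    and P :: "'a point"
    and \<sigma> :: "'a \<Rightarrow> 'a"
  assumes "number_field K"
    and "totally_imaginary K"
    and "algebraic_closure (ring_of_type_algebra :: 'a ring) K"
    and "elliptic_curve_over K E"
    and "P \<in> carrier (mordell_weil E K)"
    and "P [^]\<^bsub>mordell_weil E K\<^esub> (2 :: nat) \<noteq> \<one>\<^bsub>mordell_weil E K\<^esub>"
    and "P [^]\<^bsub>mordell_weil E K\<^esub> (3 :: nat) \<noteq> \<one>\<^bsub>mordell_weil E K\<^esub>"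
    and "\<sigma> \<in> Gal K"
  shows "abelian_rank (mordell_weil E (fixed_field \<sigma>)) = \<infinity>"
proof -
  let ?G = "mordell_weil E (fixed_field \<sigma>)"
  \<comment> \<open>\<open>abelian_rank\<close> is a supremum over finite sets, so independent sets
    of every finite size are enough.\<close>
  have "\<exists>S. int_independent ?G S \<and> card S = n" for n
  proof (induction n)
    case 0
    show ?case by (intro exI[of _ "{}"]) (simp add: int_independent_def)
  next
    case (Suc n)
    then obtain S where S: "int_independent ?G S" "card S = n" by blast
    obtain Q where "Q \<notin> S" "int_independent ?G (insert Q S)"
      by (rule extend_independent[OF assms(1,3,4,8) S(1)])
    moreover have "finite S" using S(1) by (simp add: int_independent_def)
    ultimately show ?case using S(2) by (intro exI[of _ "insert Q S"]) simp
  qed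
  then have le: "enat n \<le> abelian_rank ?G" for n
    unfolding abelian_rank_def by (metis (mono_tags, lifting) SUP_upper mem_Collect_eq)
  show ?thesis
  proof (rule ccontr)
    assume "abelian_rank ?G \<noteq> \<infinity>"
    then obtain m where "abelian_rank ?G = enat m" by auto
    then show False using le[of "Suc m"] by simp
  qed
qed

end
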